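(* Let $G(t)=(G_1(t),\ldots,G_n(t))^T$, $t\in[0,\tau]$, be a zero-mean $\mathbb{R}^n$-valued Gaussian process with continuous samples and continuous correlation function, and let $\{G_d(t)\}$, $d=(d_1,\ldots,d_n)$, be the finite dimensional (FD) models of $G(t)$ as defined in the context. Then $$\sup_{t\in[0,\tau]}\|G_d(t)-G(t)\|\ \overset{p}{\to}\ 0\quad\text{as }\min_{1\le i\le n}d_i\to\infty,$$ where $\overset{p}{\to}$ denotes convergence in probability and $\|\cdot\|$ is the $L_\infty$ norm on $\mathbb{R}^n$.
   Context: Fix $n\ge1$ and $0<\tau<\infty$; $G$ is defined on a probability space $(\Omega,\mathcal{F},P)$, and its correlation functions are $c_{ij}(s,t)=E[G_i(s)G_j(t)]$ on $[0,\tau]^2$. The $L_\infty$ norm on $\mathbb{R}^n$ is $\|x\|=\max_{1\le i\le n}|x_i|$. For each $i$, $\{\lambda_{i,k}\}_{k\ge1}$ (in non-increasing order) and $\{\varphi_{i,k}\}_{k\ge1}$ denote the eigenvalues and the corresponding orthonormal (in $L_2[0,\tau]$), continuous eigenfunctions of $c_{ii}$, i.e. $\int_0^\tau c_{ii}(s,t)\varphi_{i,k}(t)\,dt=\lambda_{i,k}\varphi_{i,k}(s)$, $s\in[0,\tau]$. For integers $d_i\ge1$ and $d=(d_1,\ldots,d_n)$, the FD model $G_d(t)=(G_{1,d_1}(t),\ldots,G_{n,d_n}(t))^T$ of $G(t)$ is defined on the same probability space by $$G_{i,d_i}(t)=\sum_{k=1}^{d_i}Z_{i,k}\,\varphi_{i,k}(t),\qquad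 Z_{i,k}(\omega)=\int_0^\tau G_i(t,\omega)\varphi_{i,k}(t)\,dt,\quad \omega\in\Omega,$$ so that $\varphi_{i,1},\ldots,\varphi_{i,d_i}$ are the eigenfunctions corresponding to the $d_i$ largest eigenvalues of $c_{ii}$. *)

theory Defs
  imports "HOL-Probability.Probability"
begin

text \<open>Point masses count as Gaussian, so that degenerate finite-dimensional distributions are
  allowed.\<close>

definition gaussian_rv :: "'a measure \<Rightarrow> ('a \<Rightarrow> real) \<Rightarrow> bool" where
  "gaussian_rv M X \<longleftrightarrow>
     X \<in> borel_measurable M \<and>
     ((\<exists>\<mu>. AE \<omega> in M. X \<omega> = \<mu>) \<or>
      (\<exists>\<mu> \<sigma>. 0 < \<sigma> \<and> distributed M lborel X (normal_density \<mu> \<sigma>)))"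

text \<open>All finite-dimensional distributions are jointly Gaussian: every finite linear combination
  of the components \<open>G t \<omega> $ i\<close>, with \<open>t \<in> T\<close>, is Gaussian.\<close>

definition gaussian_process ::
    "'a measure \<Rightarrow> real set \<Rightarrow> (real \<Rightarrow> 'a \<Rightarrow> real ^ 'n) \<Rightarrow> bool" where
  "gaussian_process M T G \<longleftrightarrow>
     (\<forall>t\<in>T. G t \<in> borel_measurable M) \<and>
     (\<forall>F a. finite F \<and> F \<subseteq> T \<longrightarrow>
        gaussian_rv M (\<lambda>\<omega>. \<Sum>t\<in>F. \<Sum>i\<in>UNIV. a t i * G t \<omega> $ i))"

definition corr ::
    "'a measure \<Rightarrow> (real \<Rightarrow> 'a \<Rightarrow> real ^ 'n) \<Rightarrow> 'n \<Rightarrow> 'n \<Rightarrow> real \<Rightarrow> real \<Rightarrow> real" where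
  "corr M G i j s t = (LINT \<omega>|M. G s \<omega> $ i * G t \<omega> $ j)"

definition eigen_eqn ::
    "real \<Rightarrow> (real \<Rightarrow> real \<Rightarrow> real) \<Rightarrow> real \<Rightarrow> (real \<Rightarrow> real) \<Rightarrow> bool" where
  "eigen_eqn \<tau> c \<mu> f \<longleftrightarrow>
     continuous_on {0..\<tau>} f \<and>
     (\<forall>s\<in>{0..\<tau>}. (LINT t:{0..\<tau>}|lborel. c s t * f t) = \<mu> * f s)"

text \<open>The sequences are indexed from 1; the values at 0 are irrelevant.  The last clause says that
  all eigenvalues are listed, with multiplicity: the eigenspace of a nonzero \<open>\<mu>\<close> is spanned by the
  listed eigenfunctions that belong to \<open>\<mu>\<close>.  It is restricted to nonzero \<open>\<mu>\<close>, because the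
  null space of the integral operator may be infinite-dimensional, and a non-increasing enumeration
  of infinitely many positive eigenvalues cannot contain 0.  If there are only finitely many
  nonzero eigenvalues, the sequences continue with eigenvalue 0.\<close>

definition eigen_system ::
    "real \<Rightarrow> (real \<Rightarrow> real \<Rightarrow> real) \<Rightarrow> (nat \<Rightarrow> real) \<Rightarrow> (nat \<Rightarrow> real \<Rightarrow> real) \<Rightarrow> bool" where
  "eigen_system \<tau> c lam \<phi> \<longleftrightarrow>
     antimono_on {1..} lam \<and>
     (\<forall>k\<ge>1. eigen_eqn \<tau> c (lam k) (\<phi> k)) \<and>
     (\<forall>j\<ge>1. \<forall>k\<ge>1. (LINT t:{0..\<tau>}|lborel. \<phi> j t * \<phi> k t) = (if j = k then 1 else 0)) \<and>
     (\<forall>\<mu> f. \<mu> \<noteq> 0 \<and> eigen_eqn \<tau> c \<mu> f \<longrightarrow>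
        (\<exists>K a. finite K \<and> K \<subseteq> {k. 1 \<le> k \<and> lam k = \<mu>} \<and>
               (\<forall>s\<in>{0..\<tau>}. f s = (\<Sum>k\<in>K. a k * \<phi> k s))))"

definition fd_coeff ::
    "real \<Rightarrow> (real \<Rightarrow> 'a \<Rightarrow> real ^ 'n) \<Rightarrow> ('n \<Rightarrow> nat \<Rightarrow> real \<Rightarrow> real) \<Rightarrow> 'n \<Rightarrow> nat \<Rightarrow> 'a \<Rightarrow> real" where
  "fd_coeff \<tau> G \<phi> i k \<omega> = (LINT t:{0..\<tau>}|lborel. G t \<omega> $ i * \<phi> i k t)"

definition fd_model ::
    "real \<Rightarrow> (real \<Rightarrow> 'a \<Rightarrow> real ^ 'n) \<Rightarrow> ('n \<Rightarrow> nat \<Rightarrow> real \<Rightarrow> real) \<Rightarrow> ('n \<Rightarrow> nat) \<Rightarrow>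
      real \<Rightarrow> 'a \<Rightarrow> real ^ 'n" where
  "fd_model \<tau> G \<phi> d t \<omega> = (\<chi> i. \<Sum>k=1..d i. fd_coeff \<tau> G \<phi> i k \<omega> * \<phi> i k t)"

text \<open>Measurability is part of the notion: \<open>measure M\<close> is 0 on non-measurable sets, so without it
  the limit could hold vacuously.\<close>

definition tendsto_in_prob ::
    "'a measure \<Rightarrow> ('b \<Rightarrow> 'a \<Rightarrow> real) \<Rightarrow> ('a \<Rightarrow> real) \<Rightarrow> 'b filter \<Rightarrow> bool" where
  "tendsto_in_prob M X Y F \<longleftrightarrow>
     (\<forall>d. X d \<in> borel_measurable M) \<and> Y \<in> borel_measurable M \<and>
     (\<forall>\<epsilon>>0. ((\<lambda>d. measure M {\<omega> \<in> space M. \<bar>X d \<omega> - Y \<omega>\<bar> > \<epsilon>}) \<longlongrightarrow> 0) F)"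

end

theory Submission
  imports Defs "HOL-Complex_Analysis.Great_Picard"
begin

text \<open>Fix a component \<open>X\<close> of the process and write \<open>X\<^sub>d\<close> for its FD model and \<open>R\<^sub>d = X - X\<^sub>d\<close> for
  the error.  By Mercer's theorem the variance of \<open>R\<^sub>d(t)\<close> tends to \<open>0\<close> for every \<open>t\<close>.  To make this
  uniform in \<open>t\<close>, note that \<open>R\<^sub>d\<close> and \<open>X\<^sub>d\<close> are jointly Gaussian and uncorrelated, so the reflected
  process \<open>R\<^sub>d - X\<^sub>d = X - 2 X\<^sub>d\<close> has the same law as \<open>X = R\<^sub>d + X\<^sub>d\<close>.  As \<open>R\<^sub>d\<close> is the average of
  \<open>X\<close> and its reflection, an oscillation of \<open>R\<^sub>d\<close> above \<open>\<epsilon>\<close> at scale \<open>\<delta>\<close> is at most twice as likely as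
  one of \<open>X\<close>, uniformly in \<open>d\<close>.  Path continuity of \<open>X\<close> therefore gives equicontinuity in
  probability of the \<open>R\<^sub>d\<close>, and the Chebyshev inequality on a finite \<open>\<delta>\<close>-net finishes the proof.\<close>

subsection \<open>Equality of joint distributions\<close>


text \<open>Equality in law of the process and its reflection must reach events about whole paths.
  Such an oscillation event is decided by countably many increments, hence is a limit of finite
  intersections, and the joint law of finitely many increments is determined by the characteristic
  functions of their linear combinations. For centered Gaussian variables these depend on
  covariances only, and flipping the sign of a summand uncorrelated with the rest leaves the
  covariances unchanged. The factor 2 is a union bound over two events of equal probability.
  Pointwise convergence of the variances suffices, because the net is finite and is fixed by the
  paths of the process before \<open>d\<close> is chosen. The FD coefficients are path integrals, so
  their Gaussian law is obtained from Riemann sums by passing to the limit in characteristic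
  functions. The delicate point in Mercer's theorem is that the listed eigenfunctions exhaust the
  kernel: whatever kernel remains must be shown to have an eigenfunction if it is not zero.\<close>

text \<open>The density \<open>2 + f\<close> is positive, so that Levy's theorem for probability measures applies to the
  normalized law of \<open>X\<close> reweighted by \<open>2 + f\<close>.\<close>

lemma (in prob_space) char_density_uniqueness:
  fixes f g :: "'a \<Rightarrow> real" and X Y :: "'a \<Rightarrow> real"
  assumes [measurable]: "f \<in> borel_measurable M" "g \<in> borel_measurable M"
    "X \<in> borel_measurable M" "Y \<in> borel_measurable M" and B[measurable]: "B \<in> sets borel"
    and f: "\<And>\<omega>. \<bar>f \<omega>\<bar> \<le> 1" and g: "\<And>\<omega>. \<bar>g \<omega>\<bar> \<le> 1"
    and XY: "\<And>s. (LINT \<omega>|M. iexp (s * X \<omega>)) = (LINT \<omega>|M. iexp (s * Y \<omega>))"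
    and fg: "\<And>s. (LINT \<omega>|M. of_real (f \<omega>) * iexp (s * X \<omega>)) = (LINT \<omega>|M. of_real (g \<omega>) * iexp (s * Y \<omega>))"
  shows "(LINT \<omega>|M. f \<omega> * indicator B (X \<omega>)) = (LINT \<omega>|M. g \<omega> * indicator B (Y \<omega>))"
proof -
  have intr: "integrable M h" if "h \<in> borel_measurable M" "\<And>\<omega>. norm (h \<omega>) \<le> C" for C and h :: "'a \<Rightarrow> 'b :: {banach,second_countable_topology}"
    by (rule integrable_const_bound[where B=C]) (use that in auto)
  \<comment> \<open>For one weighted law, normalized by \<open>C\<close>: its characteristic
    function and its value on \<open>B\<close> are affine in the corresponding integrals weighted by
    \<open>h\<close>. Since \<open>h\<close> is at least \<open>-1\<close>, the constant
    \<open>C\<close> is at least 1.\<close>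
  have *: "real_distribution (distr (density M (\<lambda>\<omega>. ennreal ((2 + h \<omega>) / C))) borel Z) \<and>
      char (distr (density M (\<lambda>\<omega>. ennreal ((2 + h \<omega>) / C))) borel Z) = (\<lambda>s.
        (2 * (LINT \<omega>|M. iexp (s * Z \<omega>)) + (LINT \<omega>|M. of_real (h \<omega>) * iexp (s * Z \<omega>))) / of_real C) \<and>
      measure (distr (density M (\<lambda>\<omega>. ennreal ((2 + h \<omega>) / C))) borel Z) B =
        (2 * (LINT \<omega>|M. indicator B (Z \<omega>)) + (LINT \<omega>|M. h \<omega> * indicator B (Z \<omega>))) / C \<and> C \<ge> 1"
    if [measurable]: "h \<in> borel_measurable M" "Z \<in> borel_measurable M" and h: "\<And>\<omega>. \<bar>h \<omega>\<bar> \<le> 1"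
      and C: "C = 2 + (LINT \<omega>|M. h \<omega>)" for h Z :: "'a \<Rightarrow> real" and C
  proof -
    have ih: "integrable M h" by (rule intr[of _ 1]) (use h in auto)
    have "(LINT \<omega>|M. h \<omega>) \<ge> (LINT \<omega>|M. -1)" 
      by (rule integral_mono) (use ih h abs_le_iff in \<open>auto, smt (verit)\<close>)
    then have C1: "C \<ge> 1" using C by (simp add: prob_space)
    have nn: "(2 + h \<omega>) / C \<ge> 0" for \<omega> using h[of \<omega>] C1 by auto
    let ?D = "density M (\<lambda>\<omega>. ennreal ((2 + h \<omega>) / C))"
    have 1: "(\<integral>\<^sup>+ \<omega>. ennreal ((2 + h \<omega>) / C) \<partial>M) = 1"
      using C C1 ih nn by (subst nn_integral_eq_integral) (auto simp: prob_space)
    have P: "prob_space ?D"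
      by (rule prob_spaceI) (simp add: emeasure_density 1 cong: nn_integral_cong)
    interpret D: prob_space ?D by (rule P)
    have "real_distribution (distr ?D borel Z)" by (rule D.real_distribution_distr) simp
    moreover have "char (distr ?D borel Z) s = (2 * (LINT \<omega>|M. iexp (s * Z \<omega>)) + (LINT \<omega>|M. of_real (h \<omega>) * iexp (s * Z \<omega>))) / of_real C" for s
    proof -
      have "char (distr ?D borel Z) s = (LINT \<omega>|M. ((2 + h \<omega>) / C) *\<^sub>R iexp (s * Z \<omega>))"
        unfolding char_def by (subst integral_distr; (subst integral_density)?) (auto simp: nn)
      also have "\<dots> = (LINT \<omega>|M. (2 * iexp (s * Z \<omega>) + of_real (h \<omega>) * iexp (s * Z \<omega>)) / of_real C)"
        by (intro Bochner_Integration.integral_cong) (auto simp: scaleR_conv_of_real field_simps)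
      also have "\<dots> = (2 * (LINT \<omega>|M. iexp (s * Z \<omega>)) + (LINT \<omega>|M. of_real (h \<omega>) * iexp (s * Z \<omega>))) / of_real C"
        by (subst integral_divide_zero, subst Bochner_Integration.integral_add) 
          (auto intro!: intr[of _ 1] integrable_mult_right simp: norm_mult h)
      finally show ?thesis .
    qed
    moreover have "measure (distr ?D borel Z) B = (2 * (LINT \<omega>|M. indicator B (Z \<omega>)) + (LINT \<omega>|M. h \<omega> * indicator B (Z \<omega>))) / C"
    proof -
      have "measure (distr ?D borel Z) B = (LINT x|distr ?D borel Z. indicator B x)"
        by simp
      also have "\<dots> = (LINT \<omega>|M. ((2 + h \<omega>) / C) *\<^sub>R indicator B (Z \<omega>))"
        by (subst integral_distr; (subst integral_density)?) (auto simp: nn)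
      also have "\<dots> = (LINT \<omega>|M. (2 * indicator B (Z \<omega>) + h \<omega> * indicator B (Z \<omega>)) / C)"
        by (intro Bochner_Integration.integral_cong) (auto simp: field_simps)
      also have "\<dots> = (2 * (LINT \<omega>|M. indicator B (Z \<omega>)) + (LINT \<omega>|M. h \<omega> * indicator B (Z \<omega>))) / C"
        by (subst integral_divide_zero, subst Bochner_Integration.integral_add) 
          (auto intro!: intr[of _ 1] integrable_mult_right simp: norm_mult h indicator_def)
      finally show ?thesis .
    qed
    ultimately show ?thesis using C1 by auto
  qed
  define C where "C = 2 + (LINT \<omega>|M. f \<omega>)"
  \<comment> \<open>The weighted transforms at \<open>s = 0\<close> show that both laws have the
    same normalizing constant.\<close>
  have "(LINT \<omega>|M. f \<omega>) = (LINT \<omega>|M. g \<omega>)"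
    using fg[of 0] by (simp add: integral_complex_of_real)
  then have C': "C = 2 + (LINT \<omega>|M. g \<omega>)" by (simp add: C_def)
  note F = *[of f X C, OF _ _ f C_def] and G = *[of g Y C, OF _ _ g C']
  have eq: "distr (density M (\<lambda>\<omega>. ennreal ((2 + f \<omega>) / C))) borel X = distr (density M (\<lambda>\<omega>. ennreal ((2 + g \<omega>) / C))) borel Y"
    by (rule Levy_uniqueness) (use F G XY fg in auto)
  \<comment> \<open>Equality of the unweighted laws cancels the contribution of the constant 2 in
    the density.\<close>
  have "distr M borel X = distr M borel Y"
  proof (rule Levy_uniqueness)
    show "char (distr M borel X) = char (distr M borel Y)"
      unfolding char_def by (intro ext) (simp add: integral_distr XY[simplified])
  qed auto
  then have "measure (distr M borel X) B = measure (distr M borel Y) B" by simp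
  then have "(LINT x|distr M borel X. indicator B x :: real) = (LINT x|distr M borel Y. indicator B x)" by simp
  then have "(LINT \<omega>|M. indicator B (X \<omega>) :: real) = (LINT \<omega>|M. indicator B (Y \<omega>))"
    by (simp only: integral_distr[OF assms(3) borel_measurable_indicator[OF B]] integral_distr[OF assms(4) borel_measurable_indicator[OF B]])
  with eq F G show ?thesis by auto
qed

text \<open>The conjugate of the \<open>h\<close>-weighted transform at \<open>-s\<close> is the
  \<open>cnj h\<close>-weighted transform at \<open>s\<close>. So the transforms for
  \<open>Re h\<close> and \<open>Im h\<close> are determined by those for \<open>h\<close>, and the
  real case applies to each part. Complex weights arise because the weight will contain exponentials
  of the other coordinates.\<close>

lemma (in prob_space) char_density_uniqueness_complex:
  fixes f g :: "'a \<Rightarrow> complex" and X Y :: "'a \<Rightarrow> real"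
  assumes [measurable]: "f \<in> borel_measurable M" "g \<in> borel_measurable M"
    "X \<in> borel_measurable M" "Y \<in> borel_measurable M" and B[measurable]: "B \<in> sets borel"
    and f: "\<And>\<omega>. norm (f \<omega>) \<le> 1" and g: "\<And>\<omega>. norm (g \<omega>) \<le> 1"
    and XY: "\<And>s. (LINT \<omega>|M. iexp (s * X \<omega>)) = (LINT \<omega>|M. iexp (s * Y \<omega>))"
    and fg: "\<And>s. (LINT \<omega>|M. f \<omega> * iexp (s * X \<omega>)) = (LINT \<omega>|M. g \<omega> * iexp (s * Y \<omega>))"
  shows "(LINT \<omega>|M. f \<omega> * indicator B (X \<omega>)) = (LINT \<omega>|M. g \<omega> * indicator B (Y \<omega>))"
proof -
  have intr: "integrable M h" if "h \<in> borel_measurable M" "\<And>\<omega>. norm (h \<omega>) \<le> C" for C and h :: "'a \<Rightarrow> complex"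
    by (rule integrable_const_bound[where B=C]) (use that in auto)
  have split: "(LINT \<omega>|M. of_real (Re (h \<omega>)) * iexp (s * Z \<omega>)) =
      ((LINT \<omega>|M. h \<omega> * iexp (s * Z \<omega>)) + cnj (LINT \<omega>|M. h \<omega> * iexp ((-s) * Z \<omega>))) / 2 \<and>
    (LINT \<omega>|M. of_real (Im (h \<omega>)) * iexp (s * Z \<omega>)) =
      ((LINT \<omega>|M. h \<omega> * iexp (s * Z \<omega>)) - cnj (LINT \<omega>|M. h \<omega> * iexp ((-s) * Z \<omega>))) / (2 * \<i>) \<and>
    (LINT \<omega>|M. h \<omega> * indicator B (Z \<omega>)) = Complex (LINT \<omega>|M. Re (h \<omega>) * indicator B (Z \<omega>)) (LINT \<omega>|M. Im (h \<omega>) * indicator B (Z \<omega>))"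
    if [measurable]: "h \<in> borel_measurable M" "Z \<in> borel_measurable M" and h: "\<And>\<omega>. norm (h \<omega>) \<le> 1"
    for h Z s
  proof -
    have i1: "integrable M (\<lambda>\<omega>. h \<omega> * iexp (s * Z \<omega>))" for s
      by (rule intr[of _ 1]) (auto simp: norm_mult h)
    have i2: "integrable M (\<lambda>\<omega>. cnj (h \<omega> * iexp (s * Z \<omega>)))" for s
      by (rule integrable_cnj[OF i1])
    have i3: "integrable M (\<lambda>\<omega>. h \<omega> * indicator B (Z \<omega>))"
      by (rule intr[of _ 1]) (auto simp: norm_mult h indicator_def)
    have c: "cnj (h \<omega> * iexp ((-s) * Z \<omega>)) = cnj (h \<omega>) * iexp (s * Z \<omega>)" for \<omega>
      by (simp add: exp_cnj)
    have r: "complex_of_real (Re z) = (z + cnj z) / 2" "complex_of_real (Im z) = (z - cnj z) / (2 * \<i>)" for z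
      by (auto simp: complex_eq_iff)
    have "(LINT \<omega>|M. of_real (Re (h \<omega>)) * iexp (s * Z \<omega>)) = (LINT \<omega>|M. (h \<omega> * iexp (s * Z \<omega>) + cnj (h \<omega> * iexp ((-s) * Z \<omega>))) / 2)"
      by (intro Bochner_Integration.integral_cong refl) (simp only: r c, simp add: field_simps)
    moreover have "(LINT \<omega>|M. of_real (Im (h \<omega>)) * iexp (s * Z \<omega>)) = (LINT \<omega>|M. (h \<omega> * iexp (s * Z \<omega>) - cnj (h \<omega> * iexp ((-s) * Z \<omega>))) / (2 * \<i>))"
      by (intro Bochner_Integration.integral_cong refl) (simp only: r c, simp add: field_simps)
    moreover have "(LINT \<omega>|M. h \<omega> * indicator B (Z \<omega>)) = Complex (LINT \<omega>|M. Re (h \<omega>) * indicator B (Z \<omega>)) (LINT \<omega>|M. Im (h \<omega>) * indicator B (Z \<omega>))"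
    proof -
      have "indicator B x = complex_of_real (indicator B x)" for x by (simp add: indicator_def)
      then show ?thesis
        using integral_Re[OF i3] integral_Im[OF i3] by (simp add: complex_eq_iff)
    qed
    moreover have "(LINT \<omega>|M. cnj (h \<omega> * iexp ((-s) * Z \<omega>))) = cnj (LINT \<omega>|M. h \<omega> * iexp ((-s) * Z \<omega>))"
      by (rule Bochner_Integration.integral_cnj[of M "\<lambda>\<omega>. h \<omega> * iexp ((-s) * Z \<omega>)"])
    ultimately show ?thesis
      using i1 i2 by (simp only: integral_divide_zero Bochner_Integration.integral_add Bochner_Integration.integral_diff simp_thms)
  qed
  have aR: "\<bar>Re z\<bar> \<le> 1" "\<bar>Im z\<bar> \<le> 1" if "norm z \<le> 1" for z
    using that abs_Re_le_cmod[of z] abs_Im_le_cmod[of z] by linarith+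
  note F = split[of f X, OF assms(1,3) f] and G = split[of g Y, OF assms(2,4) g]
  have "(LINT \<omega>|M. Re (f \<omega>) * indicator B (X \<omega>)) = (LINT \<omega>|M. Re (g \<omega>) * indicator B (Y \<omega>))"
    by (rule char_density_uniqueness; (simp only: F G fg XY)?) (use f g aR in auto)
  moreover have "(LINT \<omega>|M. Im (f \<omega>) * indicator B (X \<omega>)) = (LINT \<omega>|M. Im (g \<omega>) * indicator B (Y \<omega>))"
    by (rule char_density_uniqueness; (simp only: F G fg XY)?) (use f g aR in auto)
  ultimately show ?thesis by (simp only: F G)
qed

text \<open>The exponential factors are exchanged for indicators one coordinate at a time.\<close>

lemma (in prob_space) cramer_wold:
  fixes U V :: "'j \<Rightarrow> 'a \<Rightarrow> real"
  assumes J: "finite J" and U[measurable]: "\<And>j. j \<in> J \<Longrightarrow> U j \<in> borel_measurable M"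
    and V[measurable]: "\<And>j. j \<in> J \<Longrightarrow> V j \<in> borel_measurable M"
    and B[measurable]: "\<And>j. j \<in> J \<Longrightarrow> B j \<in> sets borel"
    and eq: "\<And>a. (LINT \<omega>|M. iexp (\<Sum>j\<in>J. a j * U j \<omega>)) = (LINT \<omega>|M. iexp (\<Sum>j\<in>J. a j * V j \<omega>))"
  shows "prob {\<omega>\<in>space M. \<forall>j\<in>J. U j \<omega> \<in> B j} = prob {\<omega>\<in>space M. \<forall>j\<in>J. V j \<omega> \<in> B j}"
proof -
  \<comment> \<open>\<open>S\<close> holds the coordinates already exchanged. The claim is made for
    all \<open>a\<close> at once, since multiplying by \<open>iexp (s * U k \<omega>)\<close> shifts
    \<open>a k\<close> by \<open>s\<close> in the induction hypothesis.\<close>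
  have *: "\<forall>a. (LINT \<omega>|M. iexp (\<Sum>j\<in>J. a j * U j \<omega>) * (\<Prod>j\<in>S. indicator (B j) (U j \<omega>))) =
       (LINT \<omega>|M. iexp (\<Sum>j\<in>J. a j * V j \<omega>) * (\<Prod>j\<in>S. indicator (B j) (V j \<omega>)))" if "S \<subseteq> J" for S
    using finite_subset[OF that J] that
  proof (induction S rule: finite_induct)
    case empty
    then show ?case using eq by simp
  next
    case (insert k S)
    then have k: "k \<in> J" and S: "\<And>j. j \<in> S \<Longrightarrow> j \<in> J" by auto
    show ?case
    proof
      fix a :: "'j \<Rightarrow> real"
      have sh2: "(\<Sum>j\<in>J. (if j = k then s else 0) * W j) = s * W k" for W and s :: real
      proof -
        have "(\<Sum>j\<in>J. (if j = k then s else 0) * W j) = (\<Sum>j\<in>J. if j = k then s * W j else 0)"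
          by (intro sum.cong) auto
        then show ?thesis using J k by simp
      qed
      have sh: "(\<Sum>j\<in>J. a j * W j) + s * W k = (\<Sum>j\<in>J. (a j + (if j = k then s else 0)) * W j)" for W s
        by (simp add: distrib_right sum.distrib sh2)
      have sh3: "iexp (\<Sum>j\<in>J. a j * W j) * p * iexp (s * W k) = iexp (\<Sum>j\<in>J. (a j + (if j = k then s else 0)) * W j) * p"
        for W s and p :: complex
        unfolding sh[symmetric] by (simp add: exp_add distrib_left mult_ac)
      have n: "norm (iexp x * (\<Prod>j\<in>S. indicator (B j) (W j)) :: complex) \<le> 1" for x and W :: "'j \<Rightarrow> real"
        by (auto simp: norm_mult indicator_def prod_norm[symmetric] intro!: prod_le_1)
      have "(LINT \<omega>|M. (iexp (\<Sum>j\<in>J. a j * U j \<omega>) * (\<Prod>j\<in>S. indicator (B j) (U j \<omega>))) * indicator (B k) (U k \<omega>)) =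
       (LINT \<omega>|M. (iexp (\<Sum>j\<in>J. a j * V j \<omega>) * (\<Prod>j\<in>S. indicator (B j) (V j \<omega>))) * indicator (B k) (V k \<omega>))"
      proof (rule char_density_uniqueness_complex)
        show "(LINT \<omega>|M. iexp (s * U k \<omega>)) = (LINT \<omega>|M. iexp (s * V k \<omega>))" for s
          using eq[of "\<lambda>j. if j = k then s else 0"] unfolding sh2 .
        show "(LINT \<omega>|M. iexp (\<Sum>j\<in>J. a j * U j \<omega>) * (\<Prod>j\<in>S. indicator (B j) (U j \<omega>)) * iexp (s * U k \<omega>)) =
          (LINT \<omega>|M. iexp (\<Sum>j\<in>J. a j * V j \<omega>) * (\<Prod>j\<in>S. indicator (B j) (V j \<omega>)) * iexp (s * V k \<omega>))" for s
        proof -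
          have "S \<subseteq> J" using insert.prems by simp
          from spec[OF insert.IH[OF this], of "\<lambda>j. a j + (if j = k then s else 0)"]
          show ?thesis
            unfolding sh3[of "\<lambda>j. U j \<omega>" for \<omega>] sh3[of "\<lambda>j. V j \<omega>" for \<omega>] .
        qed
        show "U k \<in> borel_measurable M" "V k \<in> borel_measurable M" "B k \<in> sets borel"
          using k by measurable
        show "(\<lambda>\<omega>. iexp (\<Sum>j\<in>J. a j * U j \<omega>) * (\<Prod>j\<in>S. indicator (B j) (U j \<omega>))) \<in> borel_measurable M"
          "(\<lambda>\<omega>. iexp (\<Sum>j\<in>J. a j * V j \<omega>) * (\<Prod>j\<in>S. indicator (B j) (V j \<omega>))) \<in> borel_measurable M"
          using S by measurable
      qed (rule n)+
      then show "(LINT \<omega>|M. iexp (\<Sum>j\<in>J. a j * U j \<omega>) * (\<Prod>j\<in>insert k S. indicator (B j) (U j \<omega>))) =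
         (LINT \<omega>|M. iexp (\<Sum>j\<in>J. a j * V j \<omega>) * (\<Prod>j\<in>insert k S. indicator (B j) (V j \<omega>)))"
        using insert.hyps by (simp add: mult_ac)
    qed
  qed
  have p: "(LINT \<omega>|M. (\<Prod>j\<in>J. indicator (B j) (W j \<omega>))) = complex_of_real (prob {\<omega>\<in>space M. \<forall>j\<in>J. W j \<omega> \<in> B j})"
    if [measurable]: "\<And>j. j \<in> J \<Longrightarrow> W j \<in> borel_measurable M" for W :: "'j \<Rightarrow> 'a \<Rightarrow> real"
  proof -
    have "(LINT \<omega>|M. (\<Prod>j\<in>J. indicator (B j) (W j \<omega>))) = (LINT \<omega>|M. complex_of_real (indicator {\<omega>\<in>space M. \<forall>j\<in>J. W j \<omega> \<in> B j} \<omega>))"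
      by (intro Bochner_Integration.integral_cong refl) (use J in \<open>auto simp: indicator_def\<close>)
    also have "\<dots> = prob {\<omega>\<in>space M. \<forall>j\<in>J. W j \<omega> \<in> B j}"
      by (subst integral_complex_of_real) (auto intro!: arg_cong[where f=prob])
    finally show ?thesis .
  qed
  \<comment> \<open>For \<open>S = J\<close> and \<open>a = 0\<close> only the product of indicators
    is left.\<close>
  from *[OF subset_refl] have "(LINT \<omega>|M. iexp (\<Sum>j\<in>J. 0 * U j \<omega>) * (\<Prod>j\<in>J. indicator (B j) (U j \<omega>))) =
       (LINT \<omega>|M. iexp (\<Sum>j\<in>J. 0 * V j \<omega>) * (\<Prod>j\<in>J. indicator (B j) (V j \<omega>)))" by (rule allE[where x="\<lambda>_. 0"])
  then show ?thesis by (simp add: p[OF U] p[OF V])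
qed

subsection \<open>Riemann sums\<close>


text \<open>On each cell \<open>f\<close> stays within \<open>e\<close> of its value at the left
  endpoint, so a cell costs at most \<open>e\<close> times its length; the induction adds one cell
  at a time.\<close>

lemma riemann_sum_error:
  fixes f :: "real \<Rightarrow> real" and \<tau> :: real and n :: nat
  assumes tau: "0 < \<tau>" and n: "0 < n" and f: "continuous_on {0..\<tau>} f"
    and e: "\<And>x y. \<lbrakk>x \<in> {0..\<tau>}; y \<in> {0..\<tau>}; \<bar>x - y\<bar> \<le> \<tau> / real n\<rbrakk> \<Longrightarrow> \<bar>f x - f y\<bar> \<le> e"
  shows "\<bar>\<tau> / n * (\<Sum>l<n. f (\<tau> * real l / real n)) - integral {0..\<tau>} f\<bar> \<le> \<tau> * e"
proof -
  have "\<bar>\<tau> / n * (\<Sum>l<k. f (\<tau> * real l / real n)) - integral {0..\<tau> * k / n} f\<bar> \<le> (\<tau> * k / n) * e" if "k \<le> n" for k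
    using that
  proof (induction k)
    case 0
    then show ?case by simp
  next
    case (Suc k)
    let ?a = "\<tau> * k / n" and ?b = "\<tau> * Suc k / n"
    have ab: "0 \<le> ?a" "?a \<le> ?b" "?b \<le> \<tau>"
      using tau n mult_left_mono[of "real (Suc k)" "real n" \<tau>] Suc.prems
      by (auto simp: divide_right_mono pos_divide_le_eq simp del: of_nat_Suc)
    have ba: "?b - ?a = \<tau> / n" by (simp add: field_simps add_divide_distrib)
    have int: "f integrable_on {x..y}" if "0 \<le> x" "y \<le> \<tau>" for x y
      by (rule integrable_continuous_interval, rule continuous_on_subset[OF f]) (use that in auto)
    have 1: "integral {0..?b} f = integral {0..?a} f + integral {?a..?b} f"
      by (rule Henstock_Kurzweil_Integration.integral_combine[symmetric]) (use ab int in auto)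
    have "((\<lambda>x. f ?a - f x) has_integral (\<tau> / n * f ?a - integral {?a..?b} f)) {?a..?b}"
      using has_integral_diff[OF has_integral_const_real[of "f ?a" ?a ?b] integrable_integral[OF int[of ?a ?b]]] ab ba
      by simp
    then have 2: "\<bar>\<tau> / n * f ?a - integral {?a..?b} f\<bar> \<le> e * (\<tau> / n)"
      using has_integral_bound_real[of e "{}" "\<lambda>x. f ?a - f x" _ "?a" "?b"] e[of ?a ?a] ab ba tau
        e[of ?a] by (force simp: content_real simp del: of_nat_Suc)
    have "\<bar>\<tau> / n * (\<Sum>l<k. f (\<tau> * real l / real n)) - integral {0..?a} f\<bar> \<le> ?a * e" using Suc by simp
    then show ?case unfolding 1 using 2 by (simp add: algebra_simps add_divide_distrib)
  qed
  from this[of n] show ?thesis using n by simp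
qed

lemma riemann_sum_tendsto:
  fixes f :: "real \<Rightarrow> real" and \<tau> :: real
  assumes tau: "0 < \<tau>" and f: "continuous_on {0..\<tau>} f"
  shows "(\<lambda>n. \<tau> / Suc n * (\<Sum>l<Suc n. f (\<tau> * l / Suc n))) \<longlonglongrightarrow> integral {0..\<tau>} f"
proof (rule LIMSEQ_I)
  fix r :: real assume r: "0 < r"
  define e where "e = r / (2 * \<tau>)"
  have "e > 0" "\<tau> * e < r" using r tau by (auto simp: e_def)
  have "uniformly_continuous_on {0..\<tau>} f" by (rule compact_uniformly_continuous[OF f]) simp
  then obtain d where d: "d > 0"
    "\<And>x y. x \<in> {0..\<tau>} \<Longrightarrow> y \<in> {0..\<tau>} \<Longrightarrow> dist y x < d \<Longrightarrow> dist (f y) (f x) < e" by (rule uniformly_continuous_onE) (use \<open>e > 0\<close> in blast)+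
  have "(\<lambda>n. \<tau> / real (Suc n)) \<longlonglongrightarrow> 0" by (rule LIMSEQ_Suc, rule lim_const_over_n)
  from order_tendstoD(2)[OF this d(1)] obtain N where N: "\<And>n. n \<ge> N \<Longrightarrow> \<tau> / real (Suc n) < d"
    by (auto simp: eventually_sequentially)
  have "norm (\<tau> / Suc n * (\<Sum>l<Suc n. f (\<tau> * l / Suc n)) - integral {0..\<tau>} f) < r" if "n \<ge> N" for n
    using riemann_sum_error[OF tau _ f, of "Suc n" e] d(2) N[OF that] \<open>\<tau> * e < r\<close>
    by (force simp: dist_real_def less_imp_le)
  then show "\<exists>no. \<forall>n\<ge>no. norm (\<tau> / Suc n * (\<Sum>l<Suc n. f (\<tau> * l / Suc n)) - integral {0..\<tau>} f) < r" by blast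
qed

text \<open>By uniform continuity on the square the inner Riemann sums approach the inner integrals
  uniformly in \<open>s\<close>. Replacing them costs at most \<open>\<tau> * (\<tau> * e)\<close>,
  and the one-dimensional result handles the remaining outer sum.\<close>

lemma riemann_sum_tendsto_2:
  fixes h :: "real \<Rightarrow> real \<Rightarrow> real" and \<tau> :: real
  assumes tau: "0 < \<tau>" and h: "continuous_on ({0..\<tau>} \<times> {0..\<tau>}) (\<lambda>(s, t). h s t)"
  shows "(\<lambda>n. (\<tau> / Suc n)\<^sup>2 * (\<Sum>l<Suc n. \<Sum>m<Suc n. h (\<tau> * l / Suc n) (\<tau> * m / Suc n)))
    \<longlonglongrightarrow> integral {0..\<tau>} (\<lambda>s. integral {0..\<tau>} (h s))"
proof -
  let ?g = "\<lambda>s. integral {0..\<tau>} (h s)"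
  have g: "continuous_on {0..\<tau>} ?g"
    using integral_continuous_on_param[of "{0..\<tau>}" 0 \<tau> h] h by simp
  have hs: "continuous_on {0..\<tau>} (h s)" if "s \<in> {0..\<tau>}" for s
    using continuous_on_compose2[OF h, of "{0..\<tau>}" "\<lambda>t. (s, t)"] that
    by (force intro!: continuous_intros)
  let ?R = "\<lambda>n s. \<tau> / Suc n * (\<Sum>m<Suc n. h s (\<tau> * m / Suc n))"
  have "(\<lambda>n. \<tau> / Suc n * (\<Sum>l<Suc n. ?R n (\<tau> * l / Suc n)) - \<tau> / Suc n * (\<Sum>l<Suc n. ?g (\<tau> * l / Suc n))) \<longlonglongrightarrow> 0"
  proof (rule LIMSEQ_I)
    fix r :: real assume r: "0 < r"
    define e where "e = r / (2 * \<tau> * \<tau>)"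
    have "e > 0" "\<tau> * (\<tau> * e) < r" using r tau by (auto simp: e_def)
    have "uniformly_continuous_on ({0..\<tau>} \<times> {0..\<tau>}) (\<lambda>(s, t). h s t)"
      by (rule compact_uniformly_continuous[OF h]) (simp add: compact_Times)
    then obtain d where d: "d > 0"
      "\<And>x y. x \<in> {0..\<tau>} \<times> {0..\<tau>} \<Longrightarrow> y \<in> {0..\<tau>} \<times> {0..\<tau>} \<Longrightarrow> dist y x < d
        \<Longrightarrow> dist ((\<lambda>(s, t). h s t) y) ((\<lambda>(s, t). h s t) x) < e" by (rule uniformly_continuous_onE) (use \<open>e > 0\<close> in blast)+
    have d2: "\<bar>h s x - h s y\<bar> \<le> e" if "s \<in> {0..\<tau>}" "x \<in> {0..\<tau>}" "y \<in> {0..\<tau>}" "\<bar>x - y\<bar> < d" for s x y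
      using d(2)[of "(s, y)" "(s, x)"] that by (auto simp: dist_Pair_Pair dist_real_def)
    have "(\<lambda>n. \<tau> / real (Suc n)) \<longlonglongrightarrow> 0" by (rule LIMSEQ_Suc, rule lim_const_over_n)
    from order_tendstoD(2)[OF this d(1)] obtain N where N: "\<And>n. n \<ge> N \<Longrightarrow> \<tau> / real (Suc n) < d"
      by (auto simp: eventually_sequentially)
    have "norm (\<tau> / Suc n * (\<Sum>l<Suc n. ?R n (\<tau> * l / Suc n)) - \<tau> / Suc n * (\<Sum>l<Suc n. ?g (\<tau> * l / Suc n)) - 0) < r"
      if "n \<ge> N" for n
    proof -
      have *: "\<bar>?R n s - ?g s\<bar> \<le> \<tau> * e" if s: "s \<in> {0..\<tau>}" for s
        by (rule riemann_sum_error[OF tau _ hs[OF s]]) (use d2[OF s] N[OF \<open>n \<ge> N\<close>] in auto)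
      have "\<bar>\<Sum>l<Suc n. ?R n (\<tau> * l / Suc n) - ?g (\<tau> * l / Suc n)\<bar> \<le> (\<Sum>l<Suc n. \<tau> * e)"
        by (rule order_trans[OF sum_abs sum_mono], rule *)
            (use tau mult_left_mono[of _ "real (Suc n)" \<tau>] in \<open>auto simp: pos_divide_le_eq simp del: of_nat_Suc\<close>)
      then have "\<bar>\<Sum>l<Suc n. ?R n (\<tau> * l / Suc n) - ?g (\<tau> * l / Suc n)\<bar> \<le> real (Suc n) * (\<tau> * e)"
        by simp
      then have "\<tau> / Suc n * \<bar>\<Sum>l<Suc n. ?R n (\<tau> * l / Suc n) - ?g (\<tau> * l / Suc n)\<bar> \<le> \<tau> / Suc n * (real (Suc n) * (\<tau> * e))"
        by (rule mult_left_mono) (use tau in simp)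
      also have "\<dots> = \<tau> * (\<tau> * e)" by (simp del: of_nat_Suc)
      finally have "\<bar>\<tau> / Suc n * (\<Sum>l<Suc n. ?R n (\<tau> * l / Suc n) - ?g (\<tau> * l / Suc n))\<bar> \<le> \<tau> * (\<tau> * e)"
        using tau by (simp add: abs_mult del: of_nat_Suc)
      then show ?thesis using \<open>\<tau> * (\<tau> * e) < r\<close>
        by (simp only: sum_subtractf right_diff_distrib real_norm_def diff_zero)
    qed
    then show "\<exists>no. \<forall>n\<ge>no. norm (\<tau> / Suc n * (\<Sum>l<Suc n. ?R n (\<tau> * l / Suc n)) - \<tau> / Suc n * (\<Sum>l<Suc n. ?g (\<tau> * l / Suc n)) - 0) < r"
      by blast
  qed
  from tendsto_add[OF this riemann_sum_tendsto[OF tau g]]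
  have "(\<lambda>n. \<tau> / Suc n * (\<Sum>l<Suc n. ?R n (\<tau> * l / Suc n))) \<longlonglongrightarrow> integral {0..\<tau>} ?g" by simp
  moreover have "(\<tau> / Suc n)\<^sup>2 * (\<Sum>l<Suc n. \<Sum>m<Suc n. h (\<tau> * l / Suc n) (\<tau> * m / Suc n)) = \<tau> / Suc n * (\<Sum>l<Suc n. ?R n (\<tau> * l / Suc n))" for n
    by (simp only: sum_distrib_left power2_eq_square mult.assoc)
  ultimately show ?thesis by simp
qed

subsection \<open>Eigenvalues of continuous symmetric kernels\<close>


text \<open>The common source of Cauchy-Schwarz for integrals and for positive semidefinite kernels.
  If \<open>C = 0\<close>, an affine function of \<open>x\<close> that is bounded below has slope
  0.\<close>

lemma discriminant_le_if_quadratic_nonneg: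
  fixes A B C :: real
  assumes nn: "\<And>x. 0 \<le> A + 2 * x * B + x\<^sup>2 * C" and "0 \<le> C"
  shows "B\<^sup>2 \<le> A * C"
proof (cases "C = 0")
  case True
  have "B = 0"
  proof (rule ccontr)
    assume "B \<noteq> 0"
    \<comment> \<open>This \<open>x\<close> makes \<open>A + 2 * x * B\<close> equal to
      \<open>-1\<close>.\<close>
    then have "2 * (- (A + 1) / (2 * B)) * B = - (A + 1)" by simp
    then show False using nn[of "- (A + 1) / (2 * B)"] True by simp
  qed
  then show ?thesis using True by simp
next
  case False
  then have C: "C > 0" using \<open>0 \<le> C\<close> by simp
  have "0 \<le> C * (A + 2 * (- B / C) * B + (- B / C)\<^sup>2 * C)" using nn[of "- B / C"] C by simp
  also have "\<dots> = A * C - B\<^sup>2" using C by (simp add: field_simps power2_eq_square)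
  finally show ?thesis by simp
qed

lemma integral_Cauchy_Schwarz:
  fixes f g :: "real \<Rightarrow> real"
  assumes f: "continuous_on {a..b} f" and g: "continuous_on {a..b} g"
  shows "(integral {a..b} (\<lambda>t. f t * g t))\<^sup>2 \<le> integral {a..b} (\<lambda>t. (f t)\<^sup>2) * integral {a..b} (\<lambda>t. (g t)\<^sup>2)"
proof (rule discriminant_le_if_quadratic_nonneg)
  fix x :: real
  have i: "h integrable_on {a..b}" if "continuous_on {a..b} h" for h :: "real \<Rightarrow> real"
    using that by (rule integrable_continuous_interval)
  have "0 \<le> integral {a..b} (\<lambda>t. (f t + x * g t)\<^sup>2)"
    by (intro integral_nonneg i continuous_intros f g) auto
  also have "\<dots> = integral {a..b} (\<lambda>t. (f t)\<^sup>2 + 2 * x * (f t * g t) + x\<^sup>2 * (g t)\<^sup>2)"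
    by (intro integral_cong) (simp add: power2_eq_square algebra_simps)
  also have "\<dots> = integral {a..b} (\<lambda>t. (f t)\<^sup>2) + 2 * x * integral {a..b} (\<lambda>t. f t * g t) + x\<^sup>2 * integral {a..b} (\<lambda>t. (g t)\<^sup>2)"
    by (subst Henstock_Kurzweil_Integration.integral_add, intro i continuous_intros f g, intro i continuous_intros f g,
       subst Henstock_Kurzweil_Integration.integral_add, intro i continuous_intros f g, intro i continuous_intros f g) simp
  finally show "0 \<le> \<dots>" .
qed (intro integral_nonneg integrable_continuous_interval continuous_intros g, simp)

lemma integral_square_pos:
  fixes f :: "real \<Rightarrow> real"
  assumes "continuous_on {a..b} f" "a < b" "s \<in> {a..b}" "f s \<noteq> 0"
  shows "0 < integral {a..b} (\<lambda>t. (f t)\<^sup>2)"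
proof -
  have "integral {a..b} (\<lambda>t. (f t)\<^sup>2) = 0 \<longleftrightarrow> (\<forall>x\<in>{a..b}. (f x)\<^sup>2 = 0)"
    by (rule integral_eq_0_iff) (use assms in \<open>auto intro!: continuous_intros\<close>)
  moreover have "integral {a..b} (\<lambda>t. (f t)\<^sup>2) \<ge> 0"
    by (intro integral_nonneg integrable_continuous_interval continuous_intros assms) auto
  ultimately show ?thesis using assms by force
qed

text \<open>To be instantiated with the limit of the residual kernels, not with the covariance
  function itself.\<close>

locale continuous_symmetric_kernel =
  fixes a b :: real and k :: "real \<Rightarrow> real \<Rightarrow> real"
  assumes ab: "a < b"
    and cont: "continuous_on ({a..b} \<times> {a..b}) (\<lambda>(s, t). k s t)"
    and sym: "\<And>s t. \<lbrakk>s \<in> {a..b}; t \<in> {a..b}\<rbrakk> \<Longrightarrow> k s t = k t s"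
begin

definition T :: "(real \<Rightarrow> real) \<Rightarrow> real \<Rightarrow> real" where
  "T f s = integral {a..b} (\<lambda>t. k s t * f t)"

text \<open>The \<open>L2\<close> inner product on continuous functions. This space is incomplete,
  but limits are taken uniformly after applying \<open>T\<close>, so they stay continuous.\<close>

definition ip :: "(real \<Rightarrow> real) \<Rightarrow> (real \<Rightarrow> real) \<Rightarrow> real" where
  "ip f g = integral {a..b} (\<lambda>t. f t * g t)"

abbreviation cts :: "(real \<Rightarrow> real) \<Rightarrow> bool" where
  "cts f \<equiv> continuous_on {a..b} f"

section \<open>Mapping properties of the integral operator\<close>

lemma cont1: "s \<in> {a..b} \<Longrightarrow> cts (k s)"
  using continuous_on_compose2[OF cont, of "{a..b}" "\<lambda>t. (s, t)"] by (force intro!: continuous_intros)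

lemma intble: "cts f \<Longrightarrow> f integrable_on {a..b}"
  by (rule integrable_continuous_interval)

lemma T_cts:
  assumes "cts f" shows "cts (T f)"
proof -
  have "continuous_on ({a..b} \<times> cbox a b) (\<lambda>(s, t). k s t * f t)"
    using cont assms unfolding case_prod_beta
    by (auto intro!: continuous_intros continuous_on_compose2[OF assms])
  from integral_continuous_on_param[OF this] show ?thesis unfolding T_def[abs_def] by simp
qed

lemma ip_sym: "ip f g = ip g f" by (simp add: ip_def mult.commute)

lemma ip_nonneg: "cts f \<Longrightarrow> 0 \<le> ip f f"
  unfolding ip_def by (intro integral_nonneg intble continuous_intros) auto

lemma ip_add: "\<lbrakk>cts f; cts g; cts h\<rbrakk> \<Longrightarrow> ip (\<lambda>t. f t + c * g t) h = ip f h + c * ip g h"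
  unfolding ip_def distrib_right mult.assoc
  by (subst Henstock_Kurzweil_Integration.integral_add) (auto intro!: intble continuous_intros)

lemma ip_square:
  assumes f: "cts f" and g: "cts g"
  shows "ip (\<lambda>t. f t + c * g t) (\<lambda>t. f t + c * g t) = ip f f + 2 * c * ip f g + c\<^sup>2 * ip g g"
proof -
  let ?w = "\<lambda>t. f t + c * g t"
  have w: "cts ?w" by (intro continuous_intros f g)
  have "ip ?w ?w = ip f ?w + c * ip g ?w" by (rule ip_add[OF f g w])
  also have "\<dots> = ip ?w f + c * ip ?w g" by (simp only: ip_sym[of f ?w] ip_sym[of g ?w])
  also have "\<dots> = ip f f + 2 * c * ip f g + c\<^sup>2 * ip g g"
    by (simp add: ip_add f g ip_sym[of g f] power2_eq_square algebra_simps)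
  finally show ?thesis .
qed

lemma T_add: "\<lbrakk>cts f; cts g; s \<in> {a..b}\<rbrakk> \<Longrightarrow> T (\<lambda>t. f t + c * g t) s = T f s + c * T g s"
  unfolding T_def distrib_left mult.left_commute[of _ c]
  by (subst Henstock_Kurzweil_Integration.integral_add) (auto intro!: intble continuous_intros cont1)

lemma T_selfadjoint:
  assumes f: "cts f" and g: "cts g"
  shows "ip (T f) g = ip f (T g)"
proof -
  have c: "continuous_on (cbox (a, a) (b, b)) (\<lambda>(s, t). k s t * f t * g s)"
    using cont unfolding case_prod_beta cbox_Pair_eq
    by (auto intro!: continuous_intros continuous_on_compose2[OF f] continuous_on_compose2[OF g])
  have "ip (T f) g = integral (cbox a b) (\<lambda>s. integral (cbox a b) (\<lambda>t. k s t * f t * g s))"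
    unfolding ip_def T_def by simp
  also have "\<dots> = integral (cbox a b) (\<lambda>t. integral (cbox a b) (\<lambda>s. k s t * f t * g s))"
    by (rule integral_swap_continuous[OF c])
  also have "\<dots> = integral {a..b} (\<lambda>t. integral {a..b} (\<lambda>s. f t * (k t s * g s)))"
  proof -
    have "integral {a..b} (\<lambda>s. k s t * f t * g s) = integral {a..b} (\<lambda>s. f t * (k t s * g s))"
      if "t \<in> {a..b}" for t
      using sym[OF that] by (intro integral_cong) simp
    then show ?thesis unfolding cbox_interval by (rule integral_cong)
  qed
  also have "\<dots> = ip f (T g)" unfolding ip_def T_def by simp
  finally show ?thesis .
qed

text \<open>Cauchy-Schwarz with \<open>p\<close> bounded in sup norm. With \<open>p\<close> a slice
  of the kernel it bounds \<open>T f\<close>; with \<open>p\<close> a difference of two slices it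
  bounds increments of \<open>T f\<close>.\<close>

lemma integral_mult_bound:
  assumes p: "cts p" and f: "cts f" and e: "\<And>t. t \<in> {a..b} \<Longrightarrow> \<bar>p t\<bar> \<le> e"
  shows "(integral {a..b} (\<lambda>t. p t * f t))\<^sup>2 \<le> e\<^sup>2 * (b - a) * ip f f"
proof -
  have "(integral {a..b} (\<lambda>t. p t * f t))\<^sup>2 \<le> integral {a..b} (\<lambda>t. (p t)\<^sup>2) * ip f f"
    using integral_Cauchy_Schwarz[OF p f] by (simp add: ip_def power2_eq_square)
  also have "integral {a..b} (\<lambda>t. (p t)\<^sup>2) \<le> integral {a..b} (\<lambda>t. e\<^sup>2)"
    using e by (intro integral_le intble continuous_intros p) (auto simp: abs_le_square_iff[symmetric] intro: order_trans[OF _ abs_ge_self])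
  also have "integral {a..b} (\<lambda>t. e\<^sup>2) = e\<^sup>2 * (b - a)" using ab by simp
  finally show ?thesis using ip_nonneg[OF f] by (simp add: mult_right_mono)
qed

lemma ip_bound:
  assumes f: "cts f" and e: "\<And>t. t \<in> {a..b} \<Longrightarrow> \<bar>f t\<bar> \<le> e"
  shows "ip f f \<le> e\<^sup>2 * (b - a)"
proof -
  have "ip f f \<le> integral {a..b} (\<lambda>t. e\<^sup>2)"
    unfolding ip_def power2_eq_square[symmetric]
    using e by (intro integral_le intble continuous_intros f) (auto simp: abs_le_square_iff[symmetric] intro: order_trans[OF _ abs_ge_self])
  then show ?thesis using ab by (simp add: mult.commute)
qed

lemma T_bound:
  obtains C where "C > 0" "\<And>f s. cts f \<Longrightarrow> s \<in> {a..b} \<Longrightarrow> (T f s)\<^sup>2 \<le> C * ip f f"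
proof -
  have "compact ((\<lambda>(s, t). k s t) ` ({a..b} \<times> {a..b}))"
    by (intro compact_continuous_image cont compact_Times) auto
  then have "bounded ((\<lambda>(s, t). k s t) ` ({a..b} \<times> {a..b}))" by (rule compact_imp_bounded)
  then obtain K where "K > 0" "\<forall>x\<in>(\<lambda>(s, t). k s t) ` ({a..b} \<times> {a..b}). norm x \<le> K"
    unfolding bounded_pos by (elim exE conjE)
  then have K: "K > 0" "\<And>s t. s \<in> {a..b} \<Longrightarrow> t \<in> {a..b} \<Longrightarrow> \<bar>k s t\<bar> \<le> K" by auto
  show thesis
  proof (rule that)
    show "K\<^sup>2 * (b - a) > 0" using K ab by simp
    show "(T f s)\<^sup>2 \<le> K\<^sup>2 * (b - a) * ip f f" if "cts f" "s \<in> {a..b}" for f s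
      unfolding T_def by (rule integral_mult_bound) (use that K cont1 in auto)
  qed
qed

text \<open>Together with \<open>T_bound\<close> this provides the hypotheses of Arzela-Ascoli for
  the images of the \<open>L2\<close> unit ball: control of \<open>f\<close> in mean yields
  pointwise control of \<open>T f\<close>.\<close>

lemma T_equicontinuous:
  assumes "e > 0"
  obtains d where "d > 0" "\<And>f s s'. \<lbrakk>cts f; ip f f \<le> 1; s \<in> {a..b}; s' \<in> {a..b}; \<bar>s - s'\<bar> < d\<rbrakk> \<Longrightarrow> \<bar>T f s - T f s'\<bar> < e"
proof -
  \<comment> \<open>Scaled so that the square of \<open>e'\<close> times \<open>b - a\<close> is
    half the square of \<open>e\<close>.\<close>
  define e' where "e' = e / sqrt (2 * (b - a))"
  have e': "e' > 0" "e'\<^sup>2 * (b - a) < e\<^sup>2" using assms ab by (auto simp: e'_def power_divide divide_less_eq)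
  have "uniformly_continuous_on ({a..b} \<times> {a..b}) (\<lambda>(s, t). k s t)"
    by (rule compact_uniformly_continuous[OF cont]) (simp add: compact_Times)
  then obtain d where d: "d > 0"
    "\<And>x y. x \<in> {a..b} \<times> {a..b} \<Longrightarrow> y \<in> {a..b} \<times> {a..b} \<Longrightarrow> dist y x < d
      \<Longrightarrow> dist ((\<lambda>(s, t). k s t) y) ((\<lambda>(s, t). k s t) x) < e'"
    by (rule uniformly_continuous_onE) (use \<open>e' > 0\<close> in blast)+
  show thesis
  proof (rule that[OF d(1)])
    fix f s s' assume f: "cts f" "ip f f \<le> 1" and s: "s \<in> {a..b}" "s' \<in> {a..b}" "\<bar>s - s'\<bar> < d"
    have "T f s - T f s' = integral {a..b} (\<lambda>t. (k s t - k s' t) * f t)"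
      unfolding T_def left_diff_distrib
      by (rule Henstock_Kurzweil_Integration.integral_diff[symmetric]) (use f s in \<open>auto intro!: intble continuous_intros cont1\<close>)
    moreover have "\<bar>k s t - k s' t\<bar> \<le> e'" if "t \<in> {a..b}" for t
      using d(2)[of "(s', t)" "(s, t)"] s that by (auto simp: dist_Pair_Pair dist_real_def)
    ultimately have "(T f s - T f s')\<^sup>2 \<le> e'\<^sup>2 * (b - a) * ip f f"
      by (simp only:) (rule integral_mult_bound, use f s in \<open>auto intro!: continuous_intros cont1\<close>)
    also have "\<dots> \<le> e'\<^sup>2 * (b - a) * 1" using f ab by (intro mult_left_mono) auto
    also have "\<dots> < e\<^sup>2" using e' by simp
    finally show "\<bar>T f s - T f s'\<bar> < e" using assms power2_less_imp_less[of "\<bar>T f s - T f s'\<bar>" e] by simp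
  qed
qed

text \<open>\<open>m\<close> is the squared operator norm on \<open>L\<^sub>2\<close>.  If \<open>f\<^sub>n\<close> is a maximizing sequence of unit vectors, then
  \<open>T\<^sup>2 f\<^sub>n - m f\<^sub>n\<close> tends to \<open>0\<close> in \<open>L\<^sub>2\<close>, and a uniform limit point \<open>g\<close> of \<open>T f\<^sub>n\<close> satisfies
  \<open>T\<^sup>2 g = m g\<close>.\<close>

lemma T_norm_attained:
  assumes st: "s0 \<in> {a..b}" "t0 \<in> {a..b}" "k s0 t0 \<noteq> 0"
  obtains m g s1 where "m > 0" "cts g" "\<And>s. s \<in> {a..b} \<Longrightarrow> T (T g) s = m * g s" "s1 \<in> {a..b}" "g s1 \<noteq> 0"
proof -
  obtain C where C: "C > 0" "\<And>f s. cts f \<Longrightarrow> s \<in> {a..b} \<Longrightarrow> (T f s)\<^sup>2 \<le> C * ip f f" by (rule T_bound) blast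
  \<comment> \<open>The ball rather than the sphere, so that the zero function shows
    \<open>S\<close> to be nonempty.\<close>
  define S where "S = {ip (T f) (T f) | f. cts f \<and> ip f f \<le> 1}"
  define m where "m = Sup S"
  have TTf: "ip (T f) (T f) \<le> C * (b - a) * ip f f" if "cts f" for f
  proof -
    have "ip (T f) (T f) \<le> (sqrt (C * ip f f))\<^sup>2 * (b - a)"
      using C(2)[OF that] by (intro ip_bound T_cts that) (auto intro: real_le_rsqrt)
    then show ?thesis using C ip_nonneg[OF that] by (simp add: mult_ac)
  qed
  have bdd: "bdd_above S"
  proof (rule bdd_aboveI)
    fix x assume "x \<in> S"
    then obtain f where f: "cts f" "ip f f \<le> 1" "x = ip (T f) (T f)" by (auto simp: S_def)
    have "x \<le> C * (b - a) * ip f f" using TTf[OF f(1)] f by simp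
    also have "\<dots> \<le> C * (b - a) * 1" using f C ab by (intro mult_left_mono) auto
    finally show "x \<le> C * (b - a)" by simp
  qed
  have z: "ip (\<lambda>_. 0) (\<lambda>_. 0) = 0" by (simp add: ip_def)
  have Sne: "S \<noteq> {}" using z by (auto simp: S_def intro!: exI[of _ "\<lambda>_. 0"])
  have ip_scale: "ip (\<lambda>t. c * f t) (\<lambda>t. c * f t) = c\<^sup>2 * ip f f" for c f
    unfolding ip_def by (simp add: power2_eq_square mult_ac flip: integral_mult_right)
  have T_scale: "T (\<lambda>t. c * f t) = (\<lambda>t. c * T f t)" for c f
    unfolding T_def by (simp add: mult.left_commute[of _ c])
  have m: "ip (T f) (T f) \<le> m * ip f f" if f: "cts f" for f
  proof (cases "ip f f = 0")
    case True then show ?thesis using TTf[OF f] by simp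
  next
    case False
    then have pos: "ip f f > 0" using ip_nonneg[OF f] by simp
    define c where "c = 1 / sqrt (ip f f)"
    have c2: "c\<^sup>2 * ip f f = 1" using pos by (simp add: c_def power_divide)
    have "ip (T (\<lambda>t. c * f t)) (T (\<lambda>t. c * f t)) \<in> S"
      unfolding S_def using f c2 by (auto simp: ip_scale intro!: exI[of _ "\<lambda>t. c * f t"] continuous_intros)
    then have "c\<^sup>2 * ip (T f) (T f) \<le> m"
      unfolding m_def T_scale ip_scale by (rule cSup_upper[OF _ bdd])
    then have "c\<^sup>2 * ip (T f) (T f) * ip f f \<le> m * ip f f" using pos by (intro mult_right_mono) auto
    moreover have "c\<^sup>2 * ip (T f) (T f) * ip f f = (c\<^sup>2 * ip f f) * ip (T f) (T f)" by (simp add: mult_ac)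
    ultimately show ?thesis using c2 by simp
  qed
  have ks: "cts (k s0)" by (rule cont1) fact
  \<comment> \<open>The slice \<open>k s0\<close> is the test function: \<open>T (k s0) s0\<close>
    is the integral of its square.\<close>
  have "T (k s0) s0 \<noteq> 0"
    using integral_square_pos[OF ks ab st(2,3)] by (simp add: T_def power2_eq_square)
  then have "ip (T (k s0)) (T (k s0)) > 0"
    using integral_square_pos[OF T_cts[OF ks] ab st(1)] by (simp add: ip_def power2_eq_square)
  then have mpos: "m > 0" using m[OF ks] ip_nonneg[OF ks]
    by (smt (verit) mult_nonpos_nonneg)
  have "\<exists>f. cts f \<and> ip f f \<le> 1 \<and> ip (T f) (T f) > m - 1 / Suc n" for n :: nat
    using less_cSup_iff[OF Sne bdd, of "m - 1 / Suc n"] unfolding m_def[symmetric] by (force simp: S_def)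
  then obtain f :: "nat \<Rightarrow> real \<Rightarrow> real" where f: "\<And>n. cts (f n)" "\<And>n. ip (f n) (f n) \<le> 1"
    "\<And>n. ip (T (f n)) (T (f n)) > m - 1 / Suc n" by metis
  define u where "u = (\<lambda>n. T (f n))"
  have u: "cts (u n)" for n unfolding u_def by (intro T_cts f)
  have ub: "norm (u n s) \<le> sqrt C" if "s \<in> {a..b}" for n s
  proof -
    have "(u n s)\<^sup>2 \<le> C * 1" using C(2)[OF f(1) that] f(2) C(1) unfolding u_def
      by (meson mult_left_mono order_trans less_imp_le)
    then show ?thesis using real_sqrt_le_mono[of "(u n s)\<^sup>2" C] by simp
  qed
  have ueq: "\<exists>d. 0 < d \<and> (\<forall>n y. y \<in> {a..b} \<and> norm (x - y) < d \<longrightarrow> norm (u n x - u n y) < e)"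
    if x: "x \<in> {a..b}" and "0 < e" for x e
  proof -
    obtain d where "d > 0" "\<And>f s s'. \<lbrakk>cts f; ip f f \<le> 1; s \<in> {a..b}; s' \<in> {a..b}; \<bar>s - s'\<bar> < d\<rbrakk> \<Longrightarrow> \<bar>T f s - T f s'\<bar> < e"
      by (rule T_equicontinuous[OF \<open>0 < e\<close>]) blast
    then show ?thesis using f x unfolding u_def by (intro exI[of _ d]) auto
  qed
  obtain g r where g: "cts g" and r: "strict_mono (r :: nat \<Rightarrow> nat)"
    and conv: "\<And>e. 0 < e \<Longrightarrow> \<exists>N. \<forall>n x. n \<ge> N \<and> x \<in> {a..b} \<longrightarrow> norm (u (r n) x - g x) < e"
    by (rule Arzela_Ascoli[of "{a..b}" u "sqrt C"]) (use ub ueq in auto)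
  have sub: "cts (\<lambda>t. p t + c * q t)" if "cts p" "cts q" for p q c
    using that by (intro continuous_intros)
  \<comment> \<open>Self-adjointness gives \<open>ip (T (u n)) (f n) = ip (u n) (u n)\<close>, so
    the squared norm of \<open>T (u n) - m f n\<close> is at most
    \<open>m * (m - ip (u n) (u n))\<close>, which near-maximality makes small. One further
    application of \<open>T\<close> turns smallness in mean into a pointwise bound.\<close>
  have defect: "(T (T (u n)) s - m * u n s)\<^sup>2 \<le> C * (m / Suc n)" if s: "s \<in> {a..b}" for n s
  proof -
    let ?w = "\<lambda>t. T (u n) t + (- m) * f n t"
    have "ip ?w ?w = ip (T (u n)) (T (u n)) + 2 * (- m) * ip (T (u n)) (f n) + m\<^sup>2 * ip (f n) (f n)"
      using ip_square[OF T_cts[OF u] f(1), of n "- m" n] by simp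
    also have "ip (T (u n)) (f n) = ip (u n) (u n)"
      using T_selfadjoint[OF u f(1)] by (simp add: u_def)
    also have "ip (T (u n)) (T (u n)) \<le> m * ip (u n) (u n)" by (rule m[OF u])
    also have "m\<^sup>2 * ip (f n) (f n) \<le> m\<^sup>2 * 1" using f by (intro mult_left_mono) auto
    also have "m * ip (u n) (u n) + 2 * - m * ip (u n) (u n) + m\<^sup>2 * 1 = m * (m - ip (u n) (u n))"
      by (simp add: power2_eq_square algebra_simps)
    also have "\<dots> \<le> m * (1 / Suc n)" using f(3)[of n] mpos by (intro mult_left_mono) (auto simp: u_def)
    finally have w: "ip ?w ?w \<le> m / Suc n" by simp
    have "T (T (u n)) s - m * u n s = T ?w s"
      using T_add[OF T_cts[OF u] f(1) s, of n "- m" n] by (simp add: u_def)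
    then have "(T (T (u n)) s - m * u n s)\<^sup>2 = (T ?w s)\<^sup>2" by (rule arg_cong)
    also have "\<dots> \<le> C * ip ?w ?w" by (rule C(2)[OF sub[OF T_cts[OF u] f(1)] s])
    also have "\<dots> \<le> C * (m / Suc n)" using w C(1) by (intro mult_left_mono) auto
    finally show ?thesis .
  qed
  \<comment> \<open>\<open>T\<close> preserves uniform convergence of continuous functions; this is
    used twice, to reach \<open>T (T g)\<close>.\<close>
  have T_conv: "\<forall>\<^sub>F n in sequentially. \<forall>x\<in>{a..b}. \<bar>T (p n) x - T q x\<bar> < e"
    if p: "\<And>n. cts (p n)" and q: "cts q" and "0 < e"
      and pq: "\<And>e. 0 < e \<Longrightarrow> \<forall>\<^sub>F n in sequentially. \<forall>x\<in>{a..b}. \<bar>p n x - q x\<bar> < e" for p q and e :: real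
  proof -
    define e' where "e' = e / sqrt (2 * C * (b - a))"
    have e': "e' > 0" "C * (e'\<^sup>2 * (b - a)) < e\<^sup>2" using \<open>0 < e\<close> C ab by (auto simp: e'_def power_divide divide_less_eq)
    show ?thesis using pq[OF e'(1)]
    proof eventually_elim
      case (elim n)
      show ?case
      proof
        fix x assume x: "x \<in> {a..b}"
        let ?w = "\<lambda>t. p n t + (- 1) * q t"
        have "(T ?w x)\<^sup>2 \<le> C * ip ?w ?w" by (rule C(2)[OF sub[OF p q] x])
        also have "ip ?w ?w \<le> e'\<^sup>2 * (b - a)"
          by (rule ip_bound[OF sub[OF p q]]) (use elim in \<open>auto simp: less_imp_le\<close>)
        also note e'(2)
        finally have "(T p' x - T q x)\<^sup>2 < e\<^sup>2" if "p' = p n" for p'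
          using T_add[OF p q x, of n "-1"] C(1) that by simp
        from this[OF refl] show "\<bar>T (p n) x - T q x\<bar> < e" using \<open>0 < e\<close>
            power2_less_imp_less[of "\<bar>T (p n) x - T q x\<bar>" e] by simp
      qed
    qed
  qed
  have conv': "\<forall>\<^sub>F n in sequentially. \<forall>x\<in>{a..b}. \<bar>u (r n) x - g x\<bar> < e" if "0 < e" for e
    unfolding eventually_sequentially using conv[OF that] by (simp only: real_norm_def) blast
  have conv1: "\<forall>\<^sub>F n in sequentially. \<forall>x\<in>{a..b}. \<bar>T (u (r n)) x - T g x\<bar> < e" if "0 < e" for e
    by (rule T_conv[OF u g that conv'])
  have conv2: "\<forall>\<^sub>F n in sequentially. \<forall>x\<in>{a..b}. \<bar>T (T (u (r n))) x - T (T g) x\<bar> < e" if "0 < e" for e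
    by (rule T_conv[OF T_cts[OF u] T_cts[OF g] that conv1])
  have TTg: "T (T g) s = m * g s" if s: "s \<in> {a..b}" for s
  proof -
    have l2: "(\<lambda>n. T (T (u (r n))) s) \<longlonglongrightarrow> T (T g) s"
      by (rule tendstoI, rule eventually_mono[OF conv2], assumption) (use s in \<open>auto simp: dist_real_def\<close>)
    have l0: "(\<lambda>n. u (r n) s) \<longlonglongrightarrow> g s"
      by (rule tendstoI, rule eventually_mono[OF conv'], assumption) (use s in \<open>auto simp: dist_real_def\<close>)
    have "(\<lambda>n. C * (m / Suc n)) \<longlonglongrightarrow> C * 0"
      by (intro tendsto_mult tendsto_const LIMSEQ_Suc lim_const_over_n)
    from LIMSEQ_subseq_LIMSEQ[OF this r] have z: "(\<lambda>n. C * (m / Suc (r n))) \<longlonglongrightarrow> 0" by (simp add: o_def)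
    have "(\<lambda>n. (T (T (u (r n))) s - m * u (r n) s)\<^sup>2) \<longlonglongrightarrow> 0"
      by (rule tendsto_sandwich[OF _ _ tendsto_const z]) (use defect[OF s] in auto)
    moreover have "(\<lambda>n. (T (T (u (r n))) s - m * u (r n) s)\<^sup>2) \<longlonglongrightarrow> (T (T g) s - m * g s)\<^sup>2"
      by (intro tendsto_intros l2 l0)
    ultimately have "(T (T g) s - m * g s)\<^sup>2 = 0" using LIMSEQ_unique by blast
    then show ?thesis by simp
  qed
  have "\<exists>s\<in>{a..b}. g s \<noteq> 0"
  proof (rule ccontr)
    assume "\<not> ?thesis"
    then have g0: "g s = 0" if "s \<in> {a..b}" for s using that by blast
    \<comment> \<open>If \<open>g\<close> vanished, the \<open>u (r n)\<close> would be uniformly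
      below \<open>e\<close>, and this \<open>e\<close> forces their squared norm down to
      \<open>m / 2\<close>, against its convergence to \<open>m\<close>.\<close>
    define e where "e = sqrt (m / (2 * (b - a)))"
    have e: "e > 0" "e\<^sup>2 * (b - a) = m / 2" using mpos ab by (auto simp: e_def field_simps)
    have "(\<lambda>n. 1 / real (Suc n)) \<longlonglongrightarrow> 0" by (rule LIMSEQ_Suc, rule lim_const_over_n)
    from LIMSEQ_subseq_LIMSEQ[OF this r] have "(\<lambda>n. 1 / real (Suc (r n))) \<longlonglongrightarrow> 0" by (simp add: o_def)
    from order_tendstoD(2)[OF this, of "m / 2"] have "\<forall>\<^sub>F n in sequentially. 1 / real (Suc (r n)) < m / 2"
      using mpos by simp
    then have "\<forall>\<^sub>F n in sequentially. False"
      using conv'[OF e(1)]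
    proof eventually_elim
      case (elim n)
      have "ip (u (r n)) (u (r n)) \<le> m / 2"
        unfolding e(2)[symmetric] by (rule ip_bound[OF u]) (use elim g0 in \<open>auto simp: less_imp_le\<close>)
      then show ?case using f(3)[of "r n"] elim by (simp add: u_def)
    qed
    then show False by simp
  qed
  then obtain s2 where s2: "s2 \<in> {a..b}" "g s2 \<noteq> 0" by blast
  show thesis by (rule that[OF mpos g _ s2]) (rule TTg)
qed

text \<open>\<open>(T - \<surd>m) (T + \<surd>m) g = 0\<close>, so either \<open>(T + \<surd>m) g\<close> or \<open>g\<close> is an eigenfunction.\<close>

theorem nonzero_eigenvalue:
  assumes "s0 \<in> {a..b}" "t0 \<in> {a..b}" "k s0 t0 \<noteq> 0"
  shows "\<exists>\<mu> f. \<mu> \<noteq> 0 \<and> cts f \<and> (\<forall>s\<in>{a..b}. T f s = \<mu> * f s) \<and> (\<exists>s\<in>{a..b}. f s \<noteq> 0)"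
proof -
  obtain m g s1 where g: "m > 0" "cts g" "\<And>s. s \<in> {a..b} \<Longrightarrow> T (T g) s = m * g s" "s1 \<in> {a..b}" "g s1 \<noteq> 0"
    by (rule T_norm_attained[OF assms]) blast
  let ?h = "\<lambda>t. T g t + sqrt m * g t"
  show ?thesis
  proof (cases "\<exists>s\<in>{a..b}. ?h s \<noteq> 0")
    case True
    have "T ?h s = sqrt m * ?h s" if "s \<in> {a..b}" for s
      using T_add[OF T_cts[OF g(2)] g(2) that, of "sqrt m"] g(1) g(3)[OF that] by (simp add: distrib_left)
    moreover have "cts ?h" using g(2) T_cts by (intro continuous_intros) auto
    ultimately show ?thesis using True g(1) by (intro exI[of _ "sqrt m"] exI[of _ ?h]) auto
  next
    case False
    have "T g s = (- sqrt m) * g s" if "s \<in> {a..b}" for s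
    proof -
      have "T g s + sqrt m * g s = 0" using False that by blast
      then show ?thesis by simp
    qed
    then show ?thesis using g by (intro exI[of _ "- sqrt m"] exI[of _ g]) auto
  qed
qed
end

subsection \<open>Linear functionals of a centered Gaussian process\<close>


lemma (in prob_space) gaussian_rv_integrable:
  assumes "gaussian_rv M Y" shows "integrable M Y"
proof -
  have m[measurable]: "Y \<in> borel_measurable M" using assms by (simp add: gaussian_rv_def)
  from assms consider (c) \<mu> where "AE \<omega> in M. Y \<omega> = \<mu>"
    | (n) \<mu> \<sigma> where "0 < \<sigma>" "distributed M lborel Y (normal_density \<mu> \<sigma>)"
    by (auto simp: gaussian_rv_def)
  then show ?thesis
  proof cases
    case c
    then have "integrable M Y \<longleftrightarrow> integrable M (\<lambda>_. \<mu>)" by (intro integrable_cong_AE) auto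
    then show ?thesis by simp
  next
    case n
    then show ?thesis
      using distributed_integrable[OF n(2), of "\<lambda>x. x"] integrable_normal_moment_nz_1[OF n(1)] by simp
  qed
qed

lemma (in prob_space) centered_gaussian_rv:
  assumes "gaussian_rv M Y" and mean: "expectation Y = 0"
  shows "integrable M (\<lambda>\<omega>. (Y \<omega>)\<^sup>2)"
    and "(LINT \<omega>|M. iexp (Y \<omega>)) = complex_of_real (exp (- expectation (\<lambda>\<omega>. (Y \<omega>)\<^sup>2) / 2))"
proof -
  have m[measurable]: "Y \<in> borel_measurable M" using assms by (simp add: gaussian_rv_def)
  from assms consider (c) \<mu> where "AE \<omega> in M. Y \<omega> = \<mu>"
    | (n) \<mu> \<sigma> where "0 < \<sigma>" "distributed M lborel Y (normal_density \<mu> \<sigma>)"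
    by (auto simp: gaussian_rv_def)
  then have "integrable M (\<lambda>\<omega>. (Y \<omega>)\<^sup>2) \<and>
    (LINT \<omega>|M. iexp (Y \<omega>)) = complex_of_real (exp (- expectation (\<lambda>\<omega>. (Y \<omega>)\<^sup>2) / 2))"
  proof cases
    case c
    then have "expectation Y = expectation (\<lambda>_. \<mu>)" by (intro integral_cong_AE) auto
    then have "\<mu> = 0" using mean by (simp add: prob_space)
    with c have ae: "AE \<omega> in M. Y \<omega> = 0" by simp
    then have "integrable M (\<lambda>\<omega>. (Y \<omega>)\<^sup>2) \<longleftrightarrow> integrable M (\<lambda>_. 0 :: real)"
      by (intro integrable_cong_AE) auto
    moreover have "expectation (\<lambda>\<omega>. (Y \<omega>)\<^sup>2) = expectation (\<lambda>_. 0)" using ae by (intro integral_cong_AE) auto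
    moreover have "(LINT \<omega>|M. iexp (Y \<omega>)) = (LINT \<omega>|M. 1)" using ae by (intro integral_cong_AE) auto
    ultimately show ?thesis by (simp add: prob_space)
  next
    case n
    then have "\<mu> = 0" using normal_distributed_expectation[OF n] mean by simp
    with n have d: "distributed M lborel Y (normal_density 0 \<sigma>)" by simp
    have "integrable M (\<lambda>\<omega>. (Y \<omega>)\<^sup>2)"
      using distributed_integrable[OF d, of "\<lambda>x. x\<^sup>2"] integrable_normal_moment[OF n(1), of 0 2] by simp
    moreover have var: "expectation (\<lambda>\<omega>. (Y \<omega>)\<^sup>2) = \<sigma>\<^sup>2"
      using normal_distributed_variance[OF n(1) d] mean by simp
    \<comment> \<open>The characteristic function of \<open>Y / \<sigma>\<close> at
      \<open>\<sigma>\<close> is that of \<open>Y\<close> at 1, so the standard normal formula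
      suffices.\<close>
    have "distributed M lborel (\<lambda>\<omega>. (Y \<omega> - 0) / \<sigma>) std_normal_density"
      using d normal_standard_normal_convert[OF n(1), of Y 0] by blast
    then have "distr M lborel (\<lambda>\<omega>. Y \<omega> / \<sigma>) = std_normal_distribution"
      by (simp add: distributed_def)
    moreover have "distr M lborel (\<lambda>\<omega>. Y \<omega> / \<sigma>) = distr M borel (\<lambda>\<omega>. Y \<omega> / \<sigma>)"
      by (rule distr_cong) auto
    ultimately have "char (distr M borel (\<lambda>\<omega>. Y \<omega> / \<sigma>)) \<sigma> = complex_of_real (exp (- \<sigma>\<^sup>2 / 2))"
      by (simp add: char_std_normal_distribution)
    moreover have "char (distr M borel (\<lambda>\<omega>. Y \<omega> / \<sigma>)) \<sigma> = (LINT \<omega>|M. iexp (Y \<omega>))"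
      unfolding char_def using n(1) by (subst integral_distr) (auto simp flip: of_real_mult)
    ultimately show ?thesis using var \<open>integrable M (\<lambda>\<omega>. (Y \<omega>)\<^sup>2)\<close> by simp
  qed
  then show "integrable M (\<lambda>\<omega>. (Y \<omega>)\<^sup>2)"
    and "(LINT \<omega>|M. iexp (Y \<omega>)) = complex_of_real (exp (- expectation (\<lambda>\<omega>. (Y \<omega>)\<^sup>2) / 2))" by auto
qed

text \<open>One scalar component of the process. The covariance is a parameter tied down by
  \<open>c_def\<close>, so that \<open>corr M G i i\<close> can be substituted for it
  directly.\<close>

locale centered_gaussian_process = prob_space M for M :: "'a measure" +
  fixes \<tau> :: real and X :: "real \<Rightarrow> 'a \<Rightarrow> real" and c :: "real \<Rightarrow> real \<Rightarrow> real"
  assumes tau: "0 < \<tau>"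
    and gauss: "\<And>F a. \<lbrakk>finite F; F \<subseteq> {0..\<tau>}\<rbrakk> \<Longrightarrow> gaussian_rv M (\<lambda>\<omega>. \<Sum>t\<in>F. a t * X t \<omega>)"
    and mean: "\<And>t. t \<in> {0..\<tau>} \<Longrightarrow> expectation (X t) = 0"
    and paths: "\<And>\<omega>. \<omega> \<in> space M \<Longrightarrow> continuous_on {0..\<tau>} (\<lambda>t. X t \<omega>)"
    and c_def: "\<And>s t. c s t = expectation (\<lambda>\<omega>. X s \<omega> * X t \<omega>)"
    and c_cont: "continuous_on ({0..\<tau>} \<times> {0..\<tau>}) (\<lambda>(s, t). c s t)"
begin

lemma c_sym: "c s t = c t s" by (simp add: c_def mult.commute)

lemma X_gauss: "t \<in> {0..\<tau>} \<Longrightarrow> gaussian_rv M (X t)"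
  using gauss[of "{t}" "\<lambda>_. 1"] by simp

lemma X_measurable: "t \<in> {0..\<tau>} \<Longrightarrow> X t \<in> borel_measurable M"
  using X_gauss by (simp add: gaussian_rv_def)

lemma X_integrable: "t \<in> {0..\<tau>} \<Longrightarrow> integrable M (X t)"
  using X_gauss gaussian_rv_integrable by blast

lemma XX_integrable:
  assumes "s \<in> {0..\<tau>}" "t \<in> {0..\<tau>}" shows "integrable M (\<lambda>\<omega>. X s \<omega> * X t \<omega>)"
proof (rule Bochner_Integration.integrable_bound)
  show "integrable M (\<lambda>\<omega>. (X s \<omega>)\<^sup>2 + (X t \<omega>)\<^sup>2)"
    using centered_gaussian_rv(1)[OF X_gauss mean] assms by (intro Bochner_Integration.integrable_add) auto
  show "(\<lambda>\<omega>. X s \<omega> * X t \<omega>) \<in> borel_measurable M" using X_measurable assms by measurable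
  show "AE \<omega> in M. norm (X s \<omega> * X t \<omega>) \<le> norm ((X s \<omega>)\<^sup>2 + (X t \<omega>)\<^sup>2)"
  proof (rule AE_I2)
    fix \<omega>
    have "0 \<le> (\<bar>X s \<omega>\<bar> - \<bar>X t \<omega>\<bar>)\<^sup>2" by simp
    then have "2 * (\<bar>X s \<omega>\<bar> * \<bar>X t \<omega>\<bar>) \<le> (X s \<omega>)\<^sup>2 + (X t \<omega>)\<^sup>2" by (simp add: power2_diff)
    moreover have "0 \<le> \<bar>X s \<omega>\<bar> * \<bar>X t \<omega>\<bar>" by simp
    ultimately show "norm (X s \<omega> * X t \<omega>) \<le> norm ((X s \<omega>)\<^sup>2 + (X t \<omega>)\<^sup>2)"
      unfolding real_norm_def abs_mult by linarith
  qed
qed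

text \<open>The times \<open>u j\<close> may coincide, so that evaluation points and Riemann nodes
  can later be combined freely. The Gaussian hypothesis speaks of sets of times; coefficients at
  equal times are therefore added up over the image of \<open>u\<close>.\<close>

lemma finite_combination:
  fixes J :: "'j set" and u b :: "'j \<Rightarrow> real"
  assumes J: "finite J" and u: "\<And>j. j \<in> J \<Longrightarrow> u j \<in> {0..\<tau>}"
  defines "Y \<equiv> (\<lambda>\<omega>. \<Sum>j\<in>J. b j * X (u j) \<omega>)" and "V \<equiv> (\<Sum>j\<in>J. \<Sum>l\<in>J. b j * b l * c (u j) (u l))"
  shows "Y \<in> borel_measurable M" "integrable M (\<lambda>\<omega>. (Y \<omega>)\<^sup>2)" "expectation (\<lambda>\<omega>. (Y \<omega>)\<^sup>2) = V"
    "(LINT \<omega>|M. iexp (Y \<omega>)) = complex_of_real (exp (- V / 2))"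
proof -
  have "Y = (\<lambda>\<omega>. \<Sum>t\<in>u ` J. (\<Sum>j\<in>{j\<in>J. u j = t}. b j) * X t \<omega>)"
    unfolding Y_def by (subst sum.image_gen[OF J, of _ u]) (auto simp: sum_distrib_right intro!: sum.cong)
  then have g: "gaussian_rv M Y" using gauss[of "u ` J"] J u by (auto simp: image_subset_iff)
  then show "Y \<in> borel_measurable M" by (simp add: gaussian_rv_def)
  have "expectation Y = (\<Sum>j\<in>J. b j * expectation (X (u j)))"
    unfolding Y_def using X_integrable u by (subst Bochner_Integration.integral_sum) auto
  then have e: "expectation Y = 0" using mean u by simp
  from centered_gaussian_rv(1)[OF g e] show "integrable M (\<lambda>\<omega>. (Y \<omega>)\<^sup>2)" .
  have "(\<lambda>\<omega>. (Y \<omega>)\<^sup>2) = (\<lambda>\<omega>. \<Sum>j\<in>J. \<Sum>l\<in>J. (b j * b l) * (X (u j) \<omega> * X (u l) \<omega>))"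
    unfolding Y_def power2_eq_square sum_product by (simp add: mult_ac)
  then have "expectation (\<lambda>\<omega>. (Y \<omega>)\<^sup>2) = expectation (\<lambda>\<omega>. \<Sum>j\<in>J. \<Sum>l\<in>J. (b j * b l) * (X (u j) \<omega> * X (u l) \<omega>))" by simp
  also have "\<dots> = (\<Sum>j\<in>J. \<Sum>l\<in>J. (b j * b l) * c (u j) (u l))"
    unfolding c_def using XX_integrable u
    by (subst Bochner_Integration.integral_sum, force intro!: Bochner_Integration.integrable_sum,
        intro sum.cong refl, subst Bochner_Integration.integral_sum) auto
  finally show *: "expectation (\<lambda>\<omega>. (Y \<omega>)\<^sup>2) = V" by (simp add: V_def)
  from centered_gaussian_rv(2)[OF g e] show "(LINT \<omega>|M. iexp (Y \<omega>)) = complex_of_real (exp (- V / 2))"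
    by (simp add: *)
qed

lemma c_cont1: "s \<in> {0..\<tau>} \<Longrightarrow> continuous_on {0..\<tau>} (c s)"
  using continuous_on_compose2[OF c_cont, of "{0..\<tau>}" "\<lambda>t. (s, t)"] by (force intro!: continuous_intros)

text \<open>Only an upper bound for the second moment is claimed: it comes from Fatou's lemma applied to the
  Riemann sums.\<close>

lemma integral_combination:
  fixes J :: "'j set" and u b :: "'j \<Rightarrow> real"
  assumes J: "finite J" and u: "\<And>j. j \<in> J \<Longrightarrow> u j \<in> {0..\<tau>}" and q: "continuous_on {0..\<tau>} q"
  defines "Y \<equiv> (\<lambda>\<omega>. (\<Sum>j\<in>J. b j * X (u j) \<omega>) + integral {0..\<tau>} (\<lambda>t. X t \<omega> * q t))"
    and "V \<equiv> (\<Sum>j\<in>J. \<Sum>l\<in>J. b j * b l * c (u j) (u l))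
      + 2 * (\<Sum>j\<in>J. b j * integral {0..\<tau>} (\<lambda>t. c (u j) t * q t))
      + integral {0..\<tau>} (\<lambda>s. q s * integral {0..\<tau>} (\<lambda>t. c s t * q t))"
  shows "Y \<in> borel_measurable M" "integrable M (\<lambda>\<omega>. (Y \<omega>)\<^sup>2)" "expectation (\<lambda>\<omega>. (Y \<omega>)\<^sup>2) \<le> V"
    "(LINT \<omega>|M. iexp (Y \<omega>)) = complex_of_real (exp (- V / 2))"
proof -
  define v where "v = (\<lambda>(n::nat) (l::nat). \<tau> * real l / real (Suc n))"
  have v: "v n l \<in> {0..\<tau>}" if "l < Suc n" for n l
    using tau that mult_left_mono[of "real l" "real (Suc n)" \<tau>]
    by (auto simp: v_def pos_divide_le_eq simp del: of_nat_Suc)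
  define w where "w = (\<lambda>n l. \<tau> / real (Suc n) * q (v n l))"
  \<comment> \<open>The disjoint sum merges the evaluation points with the Riemann nodes, so that
    each approximation is a single finite combination.\<close>
  define JJ where "JJ = (\<lambda>n. J <+> {..<Suc n})"
  define uu where "uu = (\<lambda>n. case_sum u (v n))"
  define bb where "bb = (\<lambda>n. case_sum b (w n))"
  define Yn where "Yn = (\<lambda>n \<omega>. \<Sum>j\<in>JJ n. bb n j * X (uu n j) \<omega>)"
  define Vn where "Vn = (\<lambda>n. \<Sum>j\<in>JJ n. \<Sum>l\<in>JJ n. bb n j * bb n l * c (uu n j) (uu n l))"
  have JJ: "finite (JJ n)" "\<And>j. j \<in> JJ n \<Longrightarrow> uu n j \<in> {0..\<tau>}" for n
    using J u v by (auto simp: JJ_def uu_def)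
  have fc: "Yn n \<in> borel_measurable M" "integrable M (\<lambda>\<omega>. (Yn n \<omega>)\<^sup>2)"
    "expectation (\<lambda>\<omega>. (Yn n \<omega>)\<^sup>2) = Vn n"
    "(LINT \<omega>|M. iexp (Yn n \<omega>)) = complex_of_real (exp (- Vn n / 2))" for n
    using finite_combination[where J="JJ n" and u="uu n" and b="bb n", OF JJ] unfolding Yn_def Vn_def by auto
  note [measurable] = fc(1)
  have Y_lim: "(\<lambda>n. Yn n \<omega>) \<longlonglongrightarrow> Y \<omega>" if "\<omega> \<in> space M" for \<omega>
  proof -
    have "Yn n \<omega> = (\<Sum>j\<in>J. b j * X (u j) \<omega>) + \<tau> / Suc n * (\<Sum>l<Suc n. X (\<tau> * l / Suc n) \<omega> * q (\<tau> * l / Suc n))" for n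
      unfolding Yn_def JJ_def
      by (subst sum.Plus) (simp_all add: J uu_def bb_def v_def w_def sum_distrib_left mult_ac del: sum.lessThan_Suc)
    moreover have "(\<lambda>n. \<tau> / Suc n * (\<Sum>l<Suc n. X (\<tau> * l / Suc n) \<omega> * q (\<tau> * l / Suc n))) \<longlonglongrightarrow> integral {0..\<tau>} (\<lambda>t. X t \<omega> * q t)"
      by (rule riemann_sum_tendsto[OF tau]) (intro continuous_intros paths that q)
    ultimately show ?thesis unfolding Y_def by (simp only:) (intro tendsto_intros)
  qed
  show Ym[measurable]: "Y \<in> borel_measurable M"
    by (rule borel_measurable_LIMSEQ_real[OF Y_lim]) auto
  have V_lim: "Vn \<longlonglongrightarrow> V"
  proof -
    have eq: "Vn n = (\<Sum>j\<in>J. \<Sum>l\<in>J. b j * b l * c (u j) (u l))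
      + 2 * (\<Sum>j\<in>J. b j * (\<tau> / Suc n * (\<Sum>l<Suc n. c (u j) (\<tau> * l / Suc n) * q (\<tau> * l / Suc n))))
      + (\<tau> / Suc n)\<^sup>2 * (\<Sum>l<Suc n. \<Sum>m<Suc n. q (\<tau> * l / Suc n) * (c (\<tau> * l / Suc n) (\<tau> * m / Suc n) * q (\<tau> * m / Suc n)))" for n
    proof -
      have 1: "(\<Sum>j\<in>J. \<Sum>l<Suc n. b j * w n l * c (u j) (v n l)) = 
        (\<Sum>j\<in>J. b j * (\<tau> / Suc n * (\<Sum>l<Suc n. c (u j) (\<tau> * l / Suc n) * q (\<tau> * l / Suc n))))"
        by (simp add: v_def w_def sum_distrib_left mult_ac del: sum.lessThan_Suc)
      \<comment> \<open>The two mixed blocks agree by symmetry of \<open>c\<close>; this is the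
        factor 2 in \<open>V\<close>.\<close>
      have 2: "(\<Sum>l<Suc n. \<Sum>j\<in>J. w n l * b j * c (v n l) (u j)) = (\<Sum>j\<in>J. \<Sum>l<Suc n. b j * w n l * c (u j) (v n l))"
        by (subst sum.swap) (simp add: c_sym mult.commute)
      have 3: "(\<Sum>l<Suc n. \<Sum>m<Suc n. w n l * w n m * c (v n l) (v n m)) =
         (\<tau> / Suc n)\<^sup>2 * (\<Sum>l<Suc n. \<Sum>m<Suc n. q (\<tau> * l / Suc n) * (c (\<tau> * l / Suc n) (\<tau> * m / Suc n) * q (\<tau> * m / Suc n)))"
        unfolding v_def w_def sum_distrib_left power2_eq_square by (intro sum.cong refl) (simp only: mult_ac)
      have "Vn n = (\<Sum>j\<in>J. \<Sum>l\<in>J. b j * b l * c (u j) (u l)) + (\<Sum>j\<in>J. \<Sum>l<Suc n. b j * w n l * c (u j) (v n l))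
        + ((\<Sum>l<Suc n. \<Sum>j\<in>J. w n l * b j * c (v n l) (u j)) + (\<Sum>l<Suc n. \<Sum>m<Suc n. w n l * w n m * c (v n l) (v n m)))"
        unfolding Vn_def JJ_def
        by (simp add: sum.Plus J uu_def bb_def o_def sum.distrib del: sum.lessThan_Suc)
      then show ?thesis unfolding 2 unfolding 1 3 by simp
    qed
    have 4: "(\<lambda>n. \<tau> / Suc n * (\<Sum>l<Suc n. c (u j) (\<tau> * l / Suc n) * q (\<tau> * l / Suc n))) \<longlonglongrightarrow> integral {0..\<tau>} (\<lambda>t. c (u j) t * q t)"
      if "j \<in> J" for j
      by (rule riemann_sum_tendsto[OF tau]) (intro continuous_intros c_cont1 u that q)
    have "(\<lambda>n. (\<tau> / Suc n)\<^sup>2 * (\<Sum>l<Suc n. \<Sum>m<Suc n. q (\<tau> * l / Suc n) * (c (\<tau> * l / Suc n) (\<tau> * m / Suc n) * q (\<tau> * m / Suc n))))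
      \<longlonglongrightarrow> integral {0..\<tau>} (\<lambda>s. integral {0..\<tau>} (\<lambda>t. q s * (c s t * q t)))"
      by (rule riemann_sum_tendsto_2[OF tau])
        (use c_cont in \<open>auto simp: case_prod_beta intro!: continuous_intros continuous_on_compose2[OF q]\<close>)
    then have 5: "(\<lambda>n. (\<tau> / Suc n)\<^sup>2 * (\<Sum>l<Suc n. \<Sum>m<Suc n. q (\<tau> * l / Suc n) * (c (\<tau> * l / Suc n) (\<tau> * m / Suc n) * q (\<tau> * m / Suc n))))
      \<longlonglongrightarrow> integral {0..\<tau>} (\<lambda>s. q s * integral {0..\<tau>} (\<lambda>t. c s t * q t))" by (simp only: integral_mult_right)
    show ?thesis unfolding eq[abs_def] V_def by (intro tendsto_intros 4 5)
  qed
  have "(\<lambda>n. LINT \<omega>|M. iexp (Yn n \<omega>)) \<longlonglongrightarrow> (LINT \<omega>|M. iexp (Y \<omega>))"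
    by (rule integral_dominated_convergence[where w="\<lambda>_. 1"])
      (auto intro!: AE_I2 tendsto_intros Y_lim)
  moreover have "(\<lambda>n. LINT \<omega>|M. iexp (Yn n \<omega>)) \<longlonglongrightarrow> complex_of_real (exp (- V / 2))"
    unfolding fc(4) by (intro tendsto_intros V_lim) simp
  ultimately show "(LINT \<omega>|M. iexp (Y \<omega>)) = complex_of_real (exp (- V / 2))" by (rule LIMSEQ_unique)
  have Vn0: "Vn n \<ge> 0" for n unfolding fc(3)[symmetric] by (rule integral_nonneg_AE) simp
  then have V0: "V \<ge> 0" using LIMSEQ_le_const[OF V_lim] by auto
  have nn: "(\<integral>\<^sup>+\<omega>. ennreal ((Y \<omega>)\<^sup>2) \<partial>M) \<le> ennreal V"
  proof -
    have "(\<integral>\<^sup>+\<omega>. ennreal ((Y \<omega>)\<^sup>2) \<partial>M) = (\<integral>\<^sup>+\<omega>. liminf (\<lambda>n. ennreal ((Yn n \<omega>)\<^sup>2)) \<partial>M)"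
    proof (rule nn_integral_cong)
      fix \<omega> assume "\<omega> \<in> space M"
      then have "(\<lambda>n. ennreal ((Yn n \<omega>)\<^sup>2)) \<longlonglongrightarrow> ennreal ((Y \<omega>)\<^sup>2)"
        by (intro tendsto_ennrealI tendsto_intros Y_lim)
      then show "ennreal ((Y \<omega>)\<^sup>2) = liminf (\<lambda>n. ennreal ((Yn n \<omega>)\<^sup>2))"
        using lim_imp_Liminf[OF trivial_limit_sequentially] by metis
    qed
    also have "\<dots> \<le> liminf (\<lambda>n. \<integral>\<^sup>+\<omega>. ennreal ((Yn n \<omega>)\<^sup>2) \<partial>M)"
      by (rule nn_integral_liminf) measurable
    also have "\<dots> = liminf (\<lambda>n. ennreal (Vn n))"
      by (subst nn_integral_eq_integral[OF fc(2)]) (auto simp: fc(3))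
    also have "\<dots> = ennreal V"
      by (rule lim_imp_Liminf) (auto intro: tendsto_ennrealI V_lim)
    finally show ?thesis .
  qed
  then show I: "integrable M (\<lambda>\<omega>. (Y \<omega>)\<^sup>2)"
    by (intro integrableI_nonneg) (auto intro: le_less_trans)
  show "expectation (\<lambda>\<omega>. (Y \<omega>)\<^sup>2) \<le> V"
    using nn V0 by (subst (asm) nn_integral_eq_integral[OF I]) auto
qed
end

subsection \<open>Residual covariance and Mercer's theorem\<close>


text \<open>Links the Lebesgue integrals of the definitions with the gauge integrals used in the
  computations.\<close>

lemma LINT_eq_integral_continuous:
  fixes f :: "real \<Rightarrow> real"
  assumes "continuous_on {a..b} f"
  shows "(LINT t:{a..b}|lborel. f t) = integral {a..b} f"
  by (rule set_borel_integral_eq_integral(2)) (rule borel_integrable_atLeastAtMost'[OF assms])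

locale karhunen_loeve = centered_gaussian_process +
  fixes lam :: "nat \<Rightarrow> real" and \<phi> :: "nat \<Rightarrow> real \<Rightarrow> real"
  assumes eigen: "eigen_system \<tau> c lam \<phi>"
begin

section \<open>Eigenfunctions and the variances of the processes \<open>W \<theta> d\<close>\<close>

lemma phi_cont: "1 \<le> k \<Longrightarrow> continuous_on {0..\<tau>} (\<phi> k)"
  using eigen by (simp add: eigen_system_def eigen_eqn_def)

lemma eigen_eqn_iff:
  assumes "continuous_on {0..\<tau>} f"
  shows "eigen_eqn \<tau> c \<mu> f \<longleftrightarrow> (\<forall>s\<in>{0..\<tau>}. integral {0..\<tau>} (\<lambda>t. c s t * f t) = \<mu> * f s)"
proof -
  have "(LINT t:{0..\<tau>}|lborel. c s t * f t) = integral {0..\<tau>} (\<lambda>t. c s t * f t)" if "s \<in> {0..\<tau>}" for s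
    by (intro LINT_eq_integral_continuous continuous_intros c_cont1 that assms)
  then show ?thesis using assms by (auto simp: eigen_eqn_def)
qed

lemma phi_eigen:
  assumes "1 \<le> k" "s \<in> {0..\<tau>}"
  shows "integral {0..\<tau>} (\<lambda>t. c s t * \<phi> k t) = lam k * \<phi> k s"
proof -
  have "eigen_eqn \<tau> c (lam k) (\<phi> k)" using eigen assms unfolding eigen_system_def by blast
  then show ?thesis using eigen_eqn_iff[OF phi_cont[OF assms(1)]] assms by blast
qed

lemma phi_orthonormal:
  assumes "1 \<le> j" "1 \<le> k"
  shows "integral {0..\<tau>} (\<lambda>t. \<phi> j t * \<phi> k t) = (if j = k then 1 else 0)"
proof -
  have "(LINT t:{0..\<tau>}|lborel. \<phi> j t * \<phi> k t) = integral {0..\<tau>} (\<lambda>t. \<phi> j t * \<phi> k t)"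
    by (intro LINT_eq_integral_continuous continuous_intros phi_cont assms)
  then show ?thesis using eigen assms by (simp add: eigen_system_def)
qed

lemma integral_phi_sum:
  assumes h: "continuous_on {0..\<tau>} h"
  shows "integral {0..\<tau>} (\<lambda>t. h t * (\<Sum>k=1..d. a k * \<phi> k t)) = (\<Sum>k=1..d. a k * integral {0..\<tau>} (\<lambda>t. h t * \<phi> k t))"
proof -
  have "integral {0..\<tau>} (\<lambda>t. h t * (\<Sum>k=1..d. a k * \<phi> k t)) = integral {0..\<tau>} (\<lambda>t. \<Sum>k=1..d. a k * (h t * \<phi> k t))"
    by (simp add: sum_distrib_left mult_ac)
  also have "\<dots> = (\<Sum>k=1..d. integral {0..\<tau>} (\<lambda>t. a k * (h t * \<phi> k t)))"
    by (rule Henstock_Kurzweil_Integration.integral_sum)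
      (auto intro!: integrable_continuous_interval continuous_intros h phi_cont)
  finally show ?thesis by simp
qed

definition Z :: "nat \<Rightarrow> 'a \<Rightarrow> real" where
  "Z k \<omega> = integral {0..\<tau>} (\<lambda>t. X t \<omega> * \<phi> k t)"

text \<open>\<open>W 0\<close> is the process itself, \<open>W 1\<close> the error of the FD model and \<open>W 2\<close> the reflected process.\<close>

definition W :: "real \<Rightarrow> nat \<Rightarrow> real \<Rightarrow> 'a \<Rightarrow> real" where
  "W \<theta> d t \<omega> = X t \<omega> - \<theta> * (\<Sum>k=1..d. Z k \<omega> * \<phi> k t)"

text \<open>Subtracting \<open>\<theta>\<close> times the FD model amounts to adding the integral of
  the path against a combination \<open>q\<close> of eigenfunctions. The mixed terms contribute
  \<open>-2 * \<theta>\<close> and the quadratic term the square of \<open>\<theta>\<close>, both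
  times the same sum over the eigenvalues.\<close>

lemma W_combination:
  fixes J :: "'j set" and u b :: "'j \<Rightarrow> real" and \<theta> :: real and d :: nat
  assumes J: "finite J" and u: "\<And>j. j \<in> J \<Longrightarrow> u j \<in> {0..\<tau>}"
  defines "Y \<equiv> (\<lambda>\<omega>. \<Sum>j\<in>J. b j * W \<theta> d (u j) \<omega>)"
    and "V \<equiv> (\<Sum>j\<in>J. \<Sum>l\<in>J. b j * b l * c (u j) (u l))
      - (2 * \<theta> - \<theta>\<^sup>2) * (\<Sum>k=1..d. lam k * (\<Sum>j\<in>J. b j * \<phi> k (u j))\<^sup>2)"
  shows "Y \<in> borel_measurable M" "integrable M (\<lambda>\<omega>. (Y \<omega>)\<^sup>2)" "expectation (\<lambda>\<omega>. (Y \<omega>)\<^sup>2) \<le> V"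
    "(LINT \<omega>|M. iexp (Y \<omega>)) = complex_of_real (exp (- V / 2))"
proof -
  define B where "B = (\<lambda>k. \<Sum>j\<in>J. b j * \<phi> k (u j))"
  \<comment> \<open>Obtained by exchanging the sums over \<open>j\<close> and \<open>k\<close> and
    collecting the coefficient of \<open>Z k \<omega>\<close>.\<close>
  define q where "q = (\<lambda>t. \<Sum>k=1..d. (- \<theta> * B k) * \<phi> k t)"
  have q: "continuous_on {0..\<tau>} q" unfolding q_def by (intro continuous_intros phi_cont) auto
  define Y' where "Y' = (\<lambda>\<omega>. (\<Sum>j\<in>J. b j * X (u j) \<omega>) + integral {0..\<tau>} (\<lambda>t. X t \<omega> * q t))"
  have YY: "Y \<omega> = Y' \<omega>" if "\<omega> \<in> space M" for \<omega>
  proof -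
    have "integral {0..\<tau>} (\<lambda>t. X t \<omega> * q t) = (\<Sum>k=1..d. (- \<theta> * B k) * Z k \<omega>)"
      unfolding q_def Z_def by (rule integral_phi_sum[OF paths[OF that]])
    also have "\<dots> = - \<theta> * (\<Sum>k=1..d. \<Sum>j\<in>J. b j * (Z k \<omega> * \<phi> k (u j)))"
      by (simp add: B_def sum_distrib_left sum_distrib_right mult_ac)
    also have "\<dots> = (\<Sum>j\<in>J. - b j * (\<theta> * (\<Sum>k=1..d. Z k \<omega> * \<phi> k (u j))))"
      by (subst sum.swap) (simp add: sum_distrib_left sum_negf mult_ac)
    finally have I: "integral {0..\<tau>} (\<lambda>t. X t \<omega> * q t) = (\<Sum>j\<in>J. - b j * (\<theta> * (\<Sum>k=1..d. Z k \<omega> * \<phi> k (u j))))" .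
    show ?thesis unfolding Y_def Y'_def I W_def
      by (simp add: right_diff_distrib sum_subtractf sum_negf)
  qed
  have cq: "integral {0..\<tau>} (\<lambda>t. c s t * q t) = (\<Sum>k=1..d. (- \<theta> * B k * lam k) * \<phi> k s)" if "s \<in> {0..\<tau>}" for s
  proof -
    have "integral {0..\<tau>} (\<lambda>t. c s t * q t) = (\<Sum>k=1..d. (- \<theta> * B k) * integral {0..\<tau>} (\<lambda>t. c s t * \<phi> k t))"
      unfolding q_def by (rule integral_phi_sum[OF c_cont1[OF that]])
    also have "\<dots> = (\<Sum>k=1..d. (- \<theta> * B k) * (lam k * \<phi> k s))"
      by (intro sum.cong refl) (use that in \<open>simp add: phi_eigen\<close>)
    finally show ?thesis by (simp add: mult_ac)
  qed
  have "(\<Sum>j\<in>J. b j * integral {0..\<tau>} (\<lambda>t. c (u j) t * q t)) = (\<Sum>j\<in>J. b j * (\<Sum>k=1..d. (- \<theta> * B k * lam k) * \<phi> k (u j)))"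
    by (intro sum.cong refl) (simp only: cq[OF u])
  also have "\<dots> = (\<Sum>j\<in>J. \<Sum>k=1..d. (- \<theta> * B k * lam k) * (b j * \<phi> k (u j)))"
    by (simp add: sum_distrib_left mult_ac)
  also have "\<dots> = (\<Sum>k=1..d. (- \<theta> * B k * lam k) * B k)"
    unfolding B_def by (subst sum.swap) (simp only: sum_distrib_left)
  also have "\<dots> = - \<theta> * (\<Sum>k=1..d. lam k * (B k)\<^sup>2)"
    unfolding sum_distrib_left by (intro sum.cong refl) (simp add: power2_eq_square)
  finally have 1: "(\<Sum>j\<in>J. b j * integral {0..\<tau>} (\<lambda>t. c (u j) t * q t)) = - \<theta> * (\<Sum>k=1..d. lam k * (B k)\<^sup>2)" .
  have qphi: "integral {0..\<tau>} (\<lambda>t. q t * \<phi> k t) = - \<theta> * B k" if k: "k \<in> {1..d}" for k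
  proof -
    have "integral {0..\<tau>} (\<lambda>t. q t * \<phi> k t) = integral {0..\<tau>} (\<lambda>t. \<phi> k t * q t)" by (simp add: mult.commute)
    also have "\<dots> = (\<Sum>l=1..d. (- \<theta> * B l) * integral {0..\<tau>} (\<lambda>t. \<phi> k t * \<phi> l t))"
      unfolding q_def by (rule integral_phi_sum) (use k phi_cont in auto)
    also have "\<dots> = (\<Sum>l=1..d. if k = l then - \<theta> * B l else 0)"
      by (intro sum.cong refl) (use k in \<open>auto simp: phi_orthonormal\<close>)
    finally show ?thesis using k by simp
  qed
  have "integral {0..\<tau>} (\<lambda>s. q s * integral {0..\<tau>} (\<lambda>t. c s t * q t))
    = integral {0..\<tau>} (\<lambda>s. q s * (\<Sum>k=1..d. (- \<theta> * B k * lam k) * \<phi> k s))"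
    by (intro integral_cong) (simp only: cq)
  also have "\<dots> = (\<Sum>k=1..d. (- \<theta> * B k * lam k) * integral {0..\<tau>} (\<lambda>t. q t * \<phi> k t))"
    by (rule integral_phi_sum[OF q])
  also have "\<dots> = (\<Sum>k=1..d. (- \<theta> * B k * lam k) * (- \<theta> * B k))"
    by (intro sum.cong refl) (simp add: qphi)
  also have "\<dots> = \<theta>\<^sup>2 * (\<Sum>k=1..d. lam k * (B k)\<^sup>2)"
    unfolding sum_distrib_left by (intro sum.cong refl) (simp add: power2_eq_square)
  finally have 2: "integral {0..\<tau>} (\<lambda>s. q s * integral {0..\<tau>} (\<lambda>t. c s t * q t)) = \<theta>\<^sup>2 * (\<Sum>k=1..d. lam k * (B k)\<^sup>2)" .
  have V: "(\<Sum>j\<in>J. \<Sum>l\<in>J. b j * b l * c (u j) (u l))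
      + 2 * (\<Sum>j\<in>J. b j * integral {0..\<tau>} (\<lambda>t. c (u j) t * q t))
      + integral {0..\<tau>} (\<lambda>s. q s * integral {0..\<tau>} (\<lambda>t. c s t * q t)) = V"
    unfolding 1 2 V_def B_def by (simp add: algebra_simps)
  note ic = integral_combination[where u=u and b=b and q=q, OF J u q, unfolded V]
  have "Y \<in> borel_measurable M \<longleftrightarrow> Y' \<in> borel_measurable M"
    by (rule measurable_cong) (rule YY)
  then show "Y \<in> borel_measurable M" using ic(1) by (simp add: Y'_def)
  have "integrable M (\<lambda>\<omega>. (Y \<omega>)\<^sup>2) \<longleftrightarrow> integrable M (\<lambda>\<omega>. (Y' \<omega>)\<^sup>2)"
    by (rule Bochner_Integration.integrable_cong[OF refl]) (simp only: YY)
  then show "integrable M (\<lambda>\<omega>. (Y \<omega>)\<^sup>2)" using ic(2) by (simp add: Y'_def)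
  have "expectation (\<lambda>\<omega>. (Y \<omega>)\<^sup>2) = expectation (\<lambda>\<omega>. (Y' \<omega>)\<^sup>2)"
    by (rule Bochner_Integration.integral_cong[OF refl]) (simp only: YY)
  then show "expectation (\<lambda>\<omega>. (Y \<omega>)\<^sup>2) \<le> V" using ic(3) by (simp add: Y'_def)
  have "(LINT \<omega>|M. iexp (Y \<omega>)) = (LINT \<omega>|M. iexp (Y' \<omega>))"
    by (rule Bochner_Integration.integral_cong[OF refl]) (simp only: YY)
  also have "\<dots> = complex_of_real (exp (- V / 2))" unfolding Y'_def by (rule ic(4))
  finally show "(LINT \<omega>|M. iexp (Y \<omega>)) = complex_of_real (exp (- V / 2))" .
qed

text \<open>The quadratic form of \<open>c\<close> at \<open>\<phi> k\<close> equals
  \<open>lam k\<close> and bounds the second moment of the \<open>k\<close>-th coefficient from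
  above; hence it cannot be negative.\<close>

lemma lam_nonneg: assumes "1 \<le> k" shows "0 \<le> lam k"
proof -
  have "integral {0..\<tau>} (\<lambda>s. \<phi> k s * integral {0..\<tau>} (\<lambda>t. c s t * \<phi> k t)) = integral {0..\<tau>} (\<lambda>s. lam k * (\<phi> k s * \<phi> k s))"
    by (intro integral_cong) (use assms in \<open>simp add: phi_eigen\<close>)
  also have "\<dots> = lam k" using phi_orthonormal[OF assms assms] by simp
  finally have l: "integral {0..\<tau>} (\<lambda>s. \<phi> k s * integral {0..\<tau>} (\<lambda>t. c s t * \<phi> k t)) = lam k" .
  have "0 \<le> expectation (\<lambda>\<omega>. (integral {0..\<tau>} (\<lambda>t. X t \<omega> * \<phi> k t))\<^sup>2)" by (rule integral_nonneg_AE) simp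
  also have "\<dots> \<le> lam k"
    using integral_combination(3)[OF finite.emptyI _ phi_cont[OF assms]] l by simp
  finally show ?thesis .
qed

text \<open>The covariance function of the error \<open>W 1 d\<close>.\<close>

definition r :: "nat \<Rightarrow> real \<Rightarrow> real \<Rightarrow> real" where
  "r d s t = c s t - (\<Sum>k=1..d. lam k * \<phi> k s * \<phi> k t)"

lemma r_sym: "r d s t = r d t s"
  by (simp add: r_def c_sym[of s t] mult_ac)

text \<open>For \<open>\<theta> = 1\<close> the factor
  \<open>2 * \<theta> - \<theta>\<^sup>2\<close> is 1, so the quadratic form is the upper bound for
  the second moment of a combination of errors; an upper bound is enough for the sign.\<close>

lemma r_positive_semidefinite:
  fixes J :: "'j set" and u b :: "'j \<Rightarrow> real"
  assumes J: "finite J" and u: "\<And>j. j \<in> J \<Longrightarrow> u j \<in> {0..\<tau>}"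
  shows "0 \<le> (\<Sum>j\<in>J. \<Sum>l\<in>J. b j * b l * r d (u j) (u l))"
proof -
  have "(\<Sum>j\<in>J. \<Sum>l\<in>J. b j * b l * (\<Sum>k=1..d. lam k * \<phi> k (u j) * \<phi> k (u l))) =
      (\<Sum>j\<in>J. \<Sum>l\<in>J. \<Sum>k=1..d. lam k * ((b j * \<phi> k (u j)) * (b l * \<phi> k (u l))))"
    by (simp add: sum_distrib_left mult_ac)
  also have "\<dots> = (\<Sum>j\<in>J. \<Sum>k=1..d. \<Sum>l\<in>J. lam k * ((b j * \<phi> k (u j)) * (b l * \<phi> k (u l))))"
    by (intro sum.cong refl sum.swap)
  also have "\<dots> = (\<Sum>k=1..d. \<Sum>j\<in>J. \<Sum>l\<in>J. lam k * ((b j * \<phi> k (u j)) * (b l * \<phi> k (u l))))"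
    by (rule sum.swap)
  also have "\<dots> = (\<Sum>k=1..d. lam k * (\<Sum>j\<in>J. b j * \<phi> k (u j))\<^sup>2)"
    unfolding power2_eq_square sum_product by (simp only: sum_distrib_left)
  finally have "(\<Sum>j\<in>J. \<Sum>l\<in>J. b j * b l * r d (u j) (u l)) = (\<Sum>j\<in>J. \<Sum>l\<in>J. b j * b l * c (u j) (u l))
      - (2 * 1 - 1\<^sup>2) * (\<Sum>k=1..d. lam k * (\<Sum>j\<in>J. b j * \<phi> k (u j))\<^sup>2)"
    unfolding r_def by (simp add: right_diff_distrib sum_subtractf)
  moreover have "0 \<le> expectation (\<lambda>\<omega>. (\<Sum>j\<in>J. b j * W 1 d (u j) \<omega>)\<^sup>2)" by (rule integral_nonneg_AE) simp
  ultimately show ?thesis using W_combination(3)[where u=u and b=b and \<theta>=1 and d=d, OF J u] by linarith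
qed

lemma r_diag_nonneg: "t \<in> {0..\<tau>} \<Longrightarrow> 0 \<le> r d t t"
  using r_positive_semidefinite[of "{()}" "\<lambda>_. t" "\<lambda>_. 1" d] by simp

lemma r_diag_le: "r d t t \<le> c t t"
  unfolding r_def
  by (simp add: mult.assoc) (intro sum_nonneg mult_nonneg_nonneg[OF lam_nonneg] zero_le_square, simp)

lemma r_Cauchy_Schwarz:
  assumes "s \<in> {0..\<tau>}" "t \<in> {0..\<tau>}"
  shows "(r d s t)\<^sup>2 \<le> r d s s * r d t t"
proof (rule discriminant_le_if_quadratic_nonneg)
  fix x :: real
  have "0 \<le> (\<Sum>j\<in>{0::nat,1}. \<Sum>l\<in>{0::nat,1}. (if j = 0 then 1 else x) * (if l = 0 then 1 else x) * 
      r d (if j = 0 then s else t) (if l = 0 then s else t))"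
    by (rule r_positive_semidefinite) (use assms in auto)
  then show "0 \<le> r d s s + 2 * x * r d s t + x\<^sup>2 * r d t t"
    by (simp add: r_sym[of d t s] power2_eq_square algebra_simps)
qed (rule r_diag_nonneg, fact)

text \<open>The variance of the increment \<open>X t - X t'\<close>.\<close>

definition D :: "real \<Rightarrow> real \<Rightarrow> real" where
  "D t t' = c t t - 2 * c t t' + c t' t'"

lemma increment_nonneg:
  assumes "t \<in> {0..\<tau>}" "t' \<in> {0..\<tau>}"
  shows "0 \<le> r d t t - 2 * r d t t' + r d t' t'"
proof -
  have "0 \<le> (\<Sum>j\<in>{0::nat,1}. \<Sum>l\<in>{0::nat,1}. (if j = 0 then 1 else -1) * (if l = 0 then 1 else -1) * 
      r d (if j = 0 then t else t') (if l = 0 then t else t'))"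
    by (rule r_positive_semidefinite) (use assms in auto)
  then show ?thesis by (simp add: r_sym[of d t' t])
qed

text \<open>Cauchy-Schwarz for the form \<open>r d\<close>, between the point \<open>s\<close> and
  the increment from \<open>t'\<close> to \<open>t\<close>. The right-hand side is free of
  \<open>d\<close>, so this modulus of continuity survives the limit in \<open>d\<close>.\<close>

lemma r_increment:
  assumes "s \<in> {0..\<tau>}" "t \<in> {0..\<tau>}" "t' \<in> {0..\<tau>}"
  shows "(r d s t - r d s t')\<^sup>2 \<le> c s s * D t t'"
proof -
  let ?C = "r d t t - 2 * r d t t' + r d t' t'"
  have C: "0 \<le> ?C" by (rule increment_nonneg) fact+
  have "(r d s t - r d s t')\<^sup>2 \<le> r d s s * ?C"
  proof (rule discriminant_le_if_quadratic_nonneg)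
    fix x :: real
    let ?u = "\<lambda>j::nat. if j = 0 then s else if j = 1 then t else t'"
    let ?b = "\<lambda>j::nat. if j = 0 then 1 else if j = 1 then x else - x"
    have "0 \<le> (\<Sum>j\<in>{0::nat,1,2}. \<Sum>l\<in>{0::nat,1,2}. ?b j * ?b l * r d (?u j) (?u l))"
      by (rule r_positive_semidefinite) (use assms in auto)
    then show "0 \<le> r d s s + 2 * x * (r d s t - r d s t') + x\<^sup>2 * ?C"
      by (simp add: r_sym[of d t s] r_sym[of d t' s] r_sym[of d t' t] power2_eq_square algebra_simps)
  qed (fact C)
  also have "\<dots> \<le> c s s * ?C" using C by (intro mult_right_mono r_diag_le)
  also have "\<dots> \<le> c s s * D t t'"
  proof (rule mult_left_mono)
    \<comment> \<open>Removing eigenterms only lowers the variance of an increment.\<close>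
    have "D t t' - ?C = (\<Sum>k=1..d. lam k * (\<phi> k t - \<phi> k t')\<^sup>2)"
      unfolding D_def r_def by (simp add: power2_eq_square algebra_simps sum.distrib sum_subtractf sum_distrib_left)
    also have "\<dots> \<ge> 0" by (intro sum_nonneg mult_nonneg_nonneg lam_nonneg) auto
    finally show "?C \<le> D t t'" by simp
    show "0 \<le> c s s" using r_diag_nonneg[OF assms(1), of 0] by (simp add: r_def)
  qed
  finally show ?thesis .
qed

text \<open>The part of the covariance that the eigenfunction expansion misses; Mercer's theorem, in
  pointwise form, says that it vanishes. \<open>lim\<close> is meaningful on the square by
  \<open>r_tendsto_R\<close>.\<close>

definition R :: "real \<Rightarrow> real \<Rightarrow> real" where
  "R s t = lim (\<lambda>d. r d s t)"

text \<open>On the diagonal the terms are nonnegative and the partial sums are at most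
  \<open>c t t\<close>, because the residual variance is nonnegative. Off the diagonal the product
  of two values is dominated by the sum of their squares.\<close>

lemma r_tendsto_R:
  assumes s: "s \<in> {0..\<tau>}" and t: "t \<in> {0..\<tau>}"
  shows "(\<lambda>d. r d s t) \<longlonglongrightarrow> R s t"
proof -
  have sq: "summable (\<lambda>k. lam (Suc k) * (\<phi> (Suc k) t)\<^sup>2)" if t: "t \<in> {0..\<tau>}" for t
  proof (rule summableI_nonneg_bounded)
    show "(\<Sum>k<n. lam (Suc k) * (\<phi> (Suc k) t)\<^sup>2) \<le> c t t" for n
    proof -
      have "(\<Sum>k<n. lam (Suc k) * (\<phi> (Suc k) t)\<^sup>2) = (\<Sum>k=1..n. lam k * \<phi> k t * \<phi> k t)"
        by (rule sum.reindex_bij_witness[of _ "\<lambda>k. k - 1" Suc]) (auto simp: power2_eq_square)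
      then show ?thesis using r_diag_nonneg[OF t, of n] by (simp add: r_def)
    qed
  qed (auto intro!: mult_nonneg_nonneg lam_nonneg)
  have "summable (\<lambda>k. lam (Suc k) * \<phi> (Suc k) s * \<phi> (Suc k) t)"
  proof (rule summable_comparison_test'[OF summable_add[OF sq[OF s] sq[OF t]]])
    fix k
    let ?x = "\<phi> (Suc k) s" and ?y = "\<phi> (Suc k) t"
    have "0 \<le> (\<bar>?x\<bar> - \<bar>?y\<bar>)\<^sup>2" by simp
    then have "2 * (\<bar>?x\<bar> * \<bar>?y\<bar>) \<le> ?x\<^sup>2 + ?y\<^sup>2" by (simp add: power2_diff)
    moreover have "0 \<le> \<bar>?x\<bar> * \<bar>?y\<bar>" by simp
    ultimately have "\<bar>?x\<bar> * \<bar>?y\<bar> \<le> ?x\<^sup>2 + ?y\<^sup>2" by linarith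
    then have "lam (Suc k) * (\<bar>?x\<bar> * \<bar>?y\<bar>) \<le> lam (Suc k) * (?x\<^sup>2 + ?y\<^sup>2)"
      by (intro mult_left_mono lam_nonneg) auto
    then show "norm (lam (Suc k) * ?x * ?y) \<le> lam (Suc k) * ?x\<^sup>2 + lam (Suc k) * ?y\<^sup>2"
      using lam_nonneg[of "Suc k"] by (simp add: abs_mult distrib_left mult.assoc)
  qed
  then have "(\<lambda>d. c s t - (\<Sum>k<d. lam (Suc k) * \<phi> (Suc k) s * \<phi> (Suc k) t)) \<longlonglongrightarrow> c s t - (\<Sum>k. lam (Suc k) * \<phi> (Suc k) s * \<phi> (Suc k) t)"
    by (intro tendsto_intros summable_LIMSEQ)
  moreover have "(\<Sum>k<d. lam (Suc k) * \<phi> (Suc k) s * \<phi> (Suc k) t) = (\<Sum>k=1..d. lam k * \<phi> k s * \<phi> k t)" for d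
    by (rule sum.reindex_bij_witness[of _ "\<lambda>k. k - 1" Suc]) auto
  ultimately have "convergent (\<lambda>d. r d s t)" by (auto simp: r_def convergent_def)
  then show ?thesis unfolding R_def by (simp add: convergent_LIMSEQ_iff)
qed

lemma c_bound: obtains K where "0 < K" "\<And>t. t \<in> {0..\<tau>} \<Longrightarrow> c t t \<le> K"
proof -
  have "continuous_on {0..\<tau>} (\<lambda>t. (\<lambda>(s, t). c s t) (t, t))"
    by (rule continuous_on_compose2[OF c_cont]) (auto intro!: continuous_intros)
  then have "compact ((\<lambda>t. c t t) ` {0..\<tau>})" by (intro compact_continuous_image) auto
  then have "bounded ((\<lambda>t. c t t) ` {0..\<tau>})" by (rule compact_imp_bounded)
  then obtain K where "K > 0" "\<forall>x\<in>(\<lambda>t. c t t) ` {0..\<tau>}. norm x \<le> K"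
    unfolding bounded_pos by (elim exE conjE)
  then show thesis using that[of K] by (auto simp: abs_le_iff)
qed

lemma R_continuous: "continuous_on ({0..\<tau>} \<times> {0..\<tau>}) (\<lambda>(s, t). R s t)"
proof -
  obtain K where K: "0 < K" "\<And>t. t \<in> {0..\<tau>} \<Longrightarrow> c t t \<le> K" by (rule c_bound) blast
  have R_sym: "R s t = R t s" for s t unfolding R_def by (simp add: r_sym[of _ s t])
  have inc: "\<bar>R s t - R s t'\<bar> \<le> sqrt (K * D t t')" if st: "s \<in> {0..\<tau>}" "t \<in> {0..\<tau>}" "t' \<in> {0..\<tau>}" for s t t'
  proof (rule real_le_rsqrt)
    have D0: "0 \<le> D t t'"
      using increment_nonneg[OF st(2,3), of 0] by (simp add: r_def D_def)
    have "(\<lambda>d. (r d s t - r d s t')\<^sup>2) \<longlonglongrightarrow> (R s t - R s t')\<^sup>2"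
      by (intro tendsto_intros r_tendsto_R st)
    then have "(R s t - R s t')\<^sup>2 \<le> c s s * D t t'"
      by (rule LIMSEQ_le_const2) (use r_increment st in auto)
    also have "\<dots> \<le> K * D t t'" using K st D0 by (intro mult_right_mono) auto
    finally show "\<bar>R s t - R s t'\<bar>\<^sup>2 \<le> K * D t t'" by simp
  qed
  have D_cont: "continuous_on {0..\<tau>} (\<lambda>x. D x y)" if "y \<in> {0..\<tau>}" for y
  proof -
    have "continuous_on {0..\<tau>} (\<lambda>x. (\<lambda>(s, t). c s t) (x, x) - 2 * (\<lambda>(s, t). c s t) (x, y) + c y y)"
      by (intro continuous_intros continuous_on_compose2[OF c_cont]) (use that in auto)
    then show ?thesis by (simp add: D_def)
  qed
  show ?thesis unfolding continuous_on_def
  proof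
    fix z assume z: "z \<in> {0..\<tau>} \<times> {0..\<tau>}"
    obtain s0 t0 where z0: "z = (s0, t0)" by (cases z)
    with z have st0: "s0 \<in> {0..\<tau>}" "t0 \<in> {0..\<tau>}" by auto
    let ?F = "at z within {0..\<tau>} \<times> {0..\<tau>}"
    have "continuous_on ({0..\<tau>} \<times> {0..\<tau>}) (\<lambda>p. sqrt (K * D (snd p) t0) + sqrt (K * D (fst p) s0))"
      by (intro continuous_intros continuous_on_compose2[OF D_cont]) (use st0 in auto)
    then have "((\<lambda>p. sqrt (K * D (snd p) t0) + sqrt (K * D (fst p) s0)) \<longlongrightarrow> sqrt (K * D (snd z) t0) + sqrt (K * D (fst z) s0)) ?F"
      using z unfolding continuous_on_def by blast
    then have lim: "((\<lambda>p. sqrt (K * D (snd p) t0) + sqrt (K * D (fst p) s0)) \<longlongrightarrow> 0) ?F"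
      by (simp add: z0 D_def)
    have "((\<lambda>p. (\<lambda>(s, t). R s t) p - R s0 t0) \<longlongrightarrow> 0) ?F"
    proof (rule Lim_null_comparison)
      show "((\<lambda>p. sqrt (K * D (snd p) t0) + sqrt (K * D (fst p) s0)) \<longlongrightarrow> 0) ?F" by (rule lim)
      have "norm ((\<lambda>(s, t). R s t) p - R s0 t0) \<le> sqrt (K * D (snd p) t0) + sqrt (K * D (fst p) s0)"
        if "p \<in> {0..\<tau>} \<times> {0..\<tau>}" for p
        using that inc[of "fst p" "snd p" t0] inc[of t0 "fst p" s0] st0
        by (auto simp: case_prod_beta R_sym[of _ t0])
      then show "\<forall>\<^sub>F p in ?F. norm ((\<lambda>(s, t). R s t) p - R s0 t0) \<le> sqrt (K * D (snd p) t0) + sqrt (K * D (fst p) s0)"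
        by (auto simp: eventually_at_filter)
    qed
    then show "((\<lambda>(s, t). R s t) \<longlongrightarrow> (\<lambda>(s, t). R s t) z) ?F"
      by (simp add: z0 LIM_zero_iff)
  qed
qed

lemma integral_r:
  assumes s: "s \<in> {0..\<tau>}" and f: "continuous_on {0..\<tau>} f"
  shows "integral {0..\<tau>} (\<lambda>t. r d s t * f t)
    = integral {0..\<tau>} (\<lambda>t. c s t * f t) - (\<Sum>k=1..d. lam k * \<phi> k s * integral {0..\<tau>} (\<lambda>t. f t * \<phi> k t))"
proof -
  have "integral {0..\<tau>} (\<lambda>t. r d s t * f t)
    = integral {0..\<tau>} (\<lambda>t. c s t * f t - f t * (\<Sum>k=1..d. (lam k * \<phi> k s) * \<phi> k t))"
    by (simp add: r_def algebra_simps)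
  also have "\<dots> = integral {0..\<tau>} (\<lambda>t. c s t * f t) - integral {0..\<tau>} (\<lambda>t. f t * (\<Sum>k=1..d. (lam k * \<phi> k s) * \<phi> k t))"
    by (rule Henstock_Kurzweil_Integration.integral_diff)
      (intro integrable_continuous_interval continuous_intros f phi_cont c_cont1 s; simp)+
  finally show ?thesis unfolding integral_phi_sum[OF f] .
qed

text \<open>Cauchy-Schwarz for \<open>r d\<close> bounds all residual kernels by the maximum
  \<open>K\<close> of the variances, which gives a dominating function.\<close>

lemma integral_r_tendsto:
  assumes s: "s \<in> {0..\<tau>}" and f: "continuous_on {0..\<tau>} f"
  shows "(\<lambda>d. integral {0..\<tau>} (\<lambda>t. r d s t * f t)) \<longlonglongrightarrow> integral {0..\<tau>} (\<lambda>t. R s t * f t)"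
proof -
  obtain K where K: "0 < K" "\<And>t. t \<in> {0..\<tau>} \<Longrightarrow> c t t \<le> K" by (rule c_bound) blast
  have rK: "\<bar>r d s t\<bar> \<le> K" if t: "t \<in> {0..\<tau>}" for d t
  proof -
    have "(r d s t)\<^sup>2 \<le> r d s s * r d t t" by (rule r_Cauchy_Schwarz[OF s t])
    also have "\<dots> \<le> K * K"
      using r_diag_nonneg[OF s, of d] r_diag_nonneg[OF t, of d] order_trans[OF r_diag_le[of d s] K(2)[OF s]]
        order_trans[OF r_diag_le[of d t] K(2)[OF t]] K(1) by (intro mult_mono) auto
    finally show ?thesis using power2_le_imp_le[of "\<bar>r d s t\<bar>" K] K(1) by (simp add: power2_eq_square)
  qed
  show ?thesis
  proof (rule dominated_convergence(2))
    show "(\<lambda>t. r d s t * f t) integrable_on {0..\<tau>}" for d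
      unfolding r_def
      by (intro integrable_continuous_interval continuous_intros f phi_cont c_cont1 s) auto
    show "(\<lambda>t. K * \<bar>f t\<bar>) integrable_on {0..\<tau>}"
      by (intro integrable_continuous_interval continuous_intros f)
    show "norm (r d s t * f t) \<le> K * \<bar>f t\<bar>" if "t \<in> {0..\<tau>}" for d t
      using rK[OF that, of d] by (simp add: abs_mult mult_right_mono)
    show "(\<lambda>d. r d s t * f t) \<longlonglongrightarrow> R s t * f t" if "t \<in> {0..\<tau>}" for t
      by (intro tendsto_intros r_tendsto_R s that)
  qed
qed

text \<open>As soon as \<open>d \<ge> k\<close>, the eigenterm of \<open>\<phi> k\<close> has been
  subtracted exactly, so the approximating sequence is eventually 0.\<close>

lemma integral_R_phi:
  assumes s: "s \<in> {0..\<tau>}" and k: "1 \<le> k"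
  shows "integral {0..\<tau>} (\<lambda>t. R s t * \<phi> k t) = 0"
proof (rule LIMSEQ_unique[OF integral_r_tendsto[OF s phi_cont[OF k]]])
  have "integral {0..\<tau>} (\<lambda>t. r d s t * \<phi> k t) = 0" if "d \<ge> k" for d
  proof -
    have "(\<Sum>l=1..d. lam l * \<phi> l s * integral {0..\<tau>} (\<lambda>t. \<phi> k t * \<phi> l t)) = (\<Sum>l=1..d. if k = l then lam l * \<phi> l s else 0)"
      by (intro sum.cong refl) (use k in \<open>auto simp: phi_orthonormal\<close>)
    also have "\<dots> = lam k * \<phi> k s" using k that by simp
    finally show ?thesis
      using integral_r[OF s phi_cont[OF k], of d] phi_eigen[OF k s] by simp
  qed
  then show "(\<lambda>d. integral {0..\<tau>} (\<lambda>t. r d s t * \<phi> k t)) \<longlonglongrightarrow> 0"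
    by (intro tendsto_eventually eventually_sequentiallyI[of k]) auto
qed

text \<open>An eigenfunction of \<open>R\<close> with nonzero eigenvalue would be orthogonal to every \<open>\<phi> k\<close> and at the same
  time an eigenfunction of \<open>c\<close>, hence a combination of the \<open>\<phi> k\<close>.\<close>

lemma R_zero:
  assumes "s \<in> {0..\<tau>}" "t \<in> {0..\<tau>}"
  shows "R s t = 0"
proof (rule ccontr)
  assume "R s t \<noteq> 0"
  have R_sym: "R s t = R t s" for s t unfolding R_def by (simp add: r_sym[of _ s t])
  interpret R: continuous_symmetric_kernel 0 \<tau> R
    by unfold_locales (rule tau R_continuous R_sym)+
  obtain \<mu> f s1 where mu: "\<mu> \<noteq> 0" and f: "continuous_on {0..\<tau>} f"
    and ev: "\<And>s. s \<in> {0..\<tau>} \<Longrightarrow> R.T f s = \<mu> * f s" and s1: "s1 \<in> {0..\<tau>}" "f s1 \<noteq> 0"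
    using R.nonzero_eigenvalue[OF assms \<open>R s t \<noteq> 0\<close>] by blast
  have orth: "integral {0..\<tau>} (\<lambda>t. f t * \<phi> k t) = 0" if k: "1 \<le> k" for k
  proof -
    have "R.ip (R.T f) (\<phi> k) = R.ip f (R.T (\<phi> k))" by (rule R.T_selfadjoint[OF f phi_cont[OF k]])
    also have "\<dots> = integral {0..\<tau>} (\<lambda>t. 0)"
      unfolding R.ip_def R.T_def by (intro integral_cong) (use k in \<open>simp add: integral_R_phi\<close>)
    finally have "R.ip (R.T f) (\<phi> k) = 0" by simp
    moreover have "R.ip (R.T f) (\<phi> k) = integral {0..\<tau>} (\<lambda>t. \<mu> * (f t * \<phi> k t))"
      unfolding R.ip_def by (intro integral_cong) (simp add: ev)
    ultimately show ?thesis using mu by simp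
  qed
  \<comment> \<open>By orthogonality the subtracted terms annihilate \<open>f\<close>: every
    \<open>r d\<close> acts on \<open>f\<close> as \<open>c\<close> does, and so does the limit
    \<open>R\<close>.\<close>
  have "integral {0..\<tau>} (\<lambda>t. c s t * f t) = \<mu> * f s" if s: "s \<in> {0..\<tau>}" for s
  proof -
    have "(\<lambda>d. integral {0..\<tau>} (\<lambda>t. c s t * f t)) \<longlonglongrightarrow> integral {0..\<tau>} (\<lambda>t. R s t * f t)"
      using integral_r_tendsto[OF s f] by (simp add: integral_r[OF s f] orth)
    then show ?thesis using ev[OF s] by (simp add: R.T_def LIMSEQ_const_iff)
  qed
  then have "eigen_eqn \<tau> c \<mu> f" by (simp add: eigen_eqn_iff[OF f])
  with mu have ev': "\<mu> \<noteq> 0 \<and> eigen_eqn \<tau> c \<mu> f" by simp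
  have all: "\<forall>\<mu> f. \<mu> \<noteq> 0 \<and> eigen_eqn \<tau> c \<mu> f \<longrightarrow> (\<exists>K a. finite K \<and> K \<subseteq> {k. 1 \<le> k \<and> lam k = \<mu>} \<and>
      (\<forall>s\<in>{0..\<tau>}. f s = (\<Sum>k\<in>K. a k * \<phi> k s)))"
    using eigen unfolding eigen_system_def by (elim conjE)
  have "\<exists>K a. finite K \<and> K \<subseteq> {k. 1 \<le> k \<and> lam k = \<mu>} \<and> (\<forall>s\<in>{0..\<tau>}. f s = (\<Sum>k\<in>K. a k * \<phi> k s))"
    by (rule all[THEN spec, THEN spec, THEN mp, OF ev'])
  then obtain K a where K: "finite K" "K \<subseteq> {k. 1 \<le> k \<and> lam k = \<mu>}" "\<And>s. s \<in> {0..\<tau>} \<Longrightarrow> f s = (\<Sum>k\<in>K. a k * \<phi> k s)"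
    by (elim exE conjE) simp
  \<comment> \<open>Expanding one factor of \<open>f\<close> in the eigenfunctions it is orthogonal
    to makes its norm 0, although \<open>f\<close> is nonzero at \<open>s1\<close>.\<close>
  have "integral {0..\<tau>} (\<lambda>t. (f t)\<^sup>2) = integral {0..\<tau>} (\<lambda>t. \<Sum>k\<in>K. a k * (f t * \<phi> k t))"
  proof (rule integral_cong)
    fix t assume "t \<in> {0..\<tau>}"
    then have "(f t)\<^sup>2 = f t * (\<Sum>k\<in>K. a k * \<phi> k t)" using K(3) by (simp add: power2_eq_square)
    then show "(f t)\<^sup>2 = (\<Sum>k\<in>K. a k * (f t * \<phi> k t))" by (simp add: sum_distrib_left mult_ac)
  qed
  also have "\<dots> = (\<Sum>k\<in>K. integral {0..\<tau>} (\<lambda>t. a k * (f t * \<phi> k t)))"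
    by (rule Henstock_Kurzweil_Integration.integral_sum[OF K(1)])
      (use K(2) in \<open>auto intro!: integrable_continuous_interval continuous_intros f phi_cont\<close>)
  also have "\<dots> = 0" using K(2) by (intro sum.neutral) (auto simp: orth)
  finally show False using integral_square_pos[OF f tau s1] by simp
qed

lemma r_diag_tendsto_0: "t \<in> {0..\<tau>} \<Longrightarrow> (\<lambda>d. r d t t) \<longlonglongrightarrow> 0"
  using r_tendsto_R[of t t] R_zero[of t t] by simp

end

subsection \<open>Uniform smallness of the error\<close>


text \<open>The strict inequality for \<open>\<delta>\<close> persists for nearby points of
  \<open>Q\<close>, and the weak one for \<open>\<epsilon>\<close> survives the limit.\<close>

lemma uniform_increment_bound_dense:
  fixes f :: "real \<Rightarrow> real"
  assumes f: "continuous_on S f" and Q: "Q \<subseteq> S" "S \<subseteq> closure Q"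
    and b: "\<And>s t. \<lbrakk>s \<in> Q; t \<in> Q; \<bar>s - t\<bar> < \<delta>\<rbrakk> \<Longrightarrow> \<bar>f s - f t\<bar> \<le> \<epsilon>"
    and st: "s \<in> S" "t \<in> S" "\<bar>s - t\<bar> < \<delta>"
  shows "\<bar>f s - f t\<bar> \<le> \<epsilon>"
proof -
  obtain x where x: "\<And>n. x n \<in> Q" "x \<longlonglongrightarrow> s" using st Q closure_sequential[of s Q] by blast
  obtain y where y: "\<And>n. y n \<in> Q" "y \<longlonglongrightarrow> t" using st Q closure_sequential[of t Q] by blast
  have fx: "(\<lambda>n. f (x n)) \<longlonglongrightarrow> f s"
    by (rule continuous_on_tendsto_compose[OF f x(2) st(1)]) (use x(1) Q(1) in \<open>auto intro!: always_eventually\<close>)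
  have fy: "(\<lambda>n. f (y n)) \<longlonglongrightarrow> f t"
    by (rule continuous_on_tendsto_compose[OF f y(2) st(2)]) (use y(1) Q(1) in \<open>auto intro!: always_eventually\<close>)
  have "(\<lambda>n. \<bar>x n - y n\<bar>) \<longlonglongrightarrow> \<bar>s - t\<bar>" by (intro tendsto_intros x y)
  then have ev: "\<forall>\<^sub>F n in sequentially. \<bar>x n - y n\<bar> < \<delta>" using st(3) by (rule order_tendstoD)
  show ?thesis
  proof (rule tendsto_upperbound)
    show "(\<lambda>n. \<bar>f (x n) - f (y n)\<bar>) \<longlonglongrightarrow> \<bar>f s - f t\<bar>" by (intro tendsto_intros fx fy)
    show "\<forall>\<^sub>F n in sequentially. \<bar>f (x n) - f (y n)\<bar> \<le> \<epsilon>"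
      using ev by eventually_elim (rule b[OF x(1) y(1)])
  qed simp
qed

text \<open>Serves to reduce the supremum over the time interval to a countable one, which is
  measurable.\<close>

lemma cSUP_dense:
  fixes f :: "real \<Rightarrow> real"
  assumes f: "continuous_on S f" and S: "compact S" and Q: "Q \<subseteq> S" "S \<subseteq> closure Q" "Q \<noteq> {}"
  shows "(SUP t\<in>S. f t) = (SUP t\<in>Q. f t)"
proof (rule antisym)
  have S_eq: "closure Q = S" using Q closure_minimal[OF Q(1) compact_imp_closed[OF S]] by blast
  have bdd: "bdd_above (f ` S)"
    using compact_continuous_image[OF f S] by (simp add: bounded_imp_bdd_above compact_imp_bounded)
  then have bddQ: "bdd_above (f ` Q)" using Q(1) by (meson bdd_above_mono image_mono)
  show "(SUP t\<in>S. f t) \<le> (SUP t\<in>Q. f t)"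
  proof (rule cSUP_least)
    show "S \<noteq> {}" using Q by auto
    fix t assume "t \<in> S"
    show "f t \<le> (SUP t\<in>Q. f t)"
      by (rule continuous_le_on_closure[of Q f]) (use f S_eq \<open>t \<in> S\<close> bddQ in \<open>auto intro: cSUP_upper\<close>)
  qed
  show "(SUP t\<in>Q. f t) \<le> (SUP t\<in>S. f t)"
    using Q bdd by (intro cSUP_subset_mono) auto
qed

section \<open>Oscillation events and their probabilities\<close>

context karhunen_loeve begin

lemma W_paths: "\<omega> \<in> space M \<Longrightarrow> continuous_on {0..\<tau>} (\<lambda>t. W \<theta> d t \<omega>)"
  unfolding W_def by (intro continuous_intros paths phi_cont) auto

lemma W_measurable: "t \<in> {0..\<tau>} \<Longrightarrow> W \<theta> d t \<in> borel_measurable M"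
  using W_combination(1)[of "{()}" "\<lambda>_. t" "\<lambda>_. 1" \<theta> d] by simp

text \<open>Strict in \<open>\<delta>\<close> and weak in \<open>\<epsilon>\<close>, so that a dense
  set of times decides the event when paths are continuous.\<close>

definition calm :: "real \<Rightarrow> real \<Rightarrow> (real \<Rightarrow> 'a \<Rightarrow> real) \<Rightarrow> 'a set" where
  "calm \<delta> \<epsilon> Y = {\<omega>\<in>space M. \<forall>s\<in>{0..\<tau>}. \<forall>t\<in>{0..\<tau>}. \<bar>s - t\<bar> < \<delta> \<longrightarrow> \<bar>Y s \<omega> - Y t \<omega>\<bar> \<le> \<epsilon>}"

text \<open>The variances of linear combinations of \<open>W \<theta> d\<close> depend on \<open>\<theta>\<close> only through \<open>2 \<theta> - \<theta>\<^sup>2\<close>, which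
  vanishes for both \<open>\<theta> = 0\<close> and \<open>\<theta> = 2\<close>.\<close>

lemma prob_increments_W:
  fixes J :: "'j set" and s t :: "'j \<Rightarrow> real"
  assumes J: "finite J" and st: "\<And>j. j \<in> J \<Longrightarrow> s j \<in> {0..\<tau>} \<and> t j \<in> {0..\<tau>}"
  shows "prob {\<omega>\<in>space M. \<forall>j\<in>J. W 2 d (s j) \<omega> - W 2 d (t j) \<omega> \<in> {-\<epsilon>..\<epsilon>}}
    = prob {\<omega>\<in>space M. \<forall>j\<in>J. W 0 d (s j) \<omega> - W 0 d (t j) \<omega> \<in> {-\<epsilon>..\<epsilon>}}"
proof (rule cramer_wold[OF J])
  fix a :: "'j \<Rightarrow> real"
  \<comment> \<open>An increment is a combination of two point values with opposite coefficients;
    the Boolean selects the endpoint.\<close>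
  let ?J = "J \<times> (UNIV :: bool set)"
  define u where "u = (\<lambda>(j, p). if p then s j else t j)"
  define b where "b = (\<lambda>(j, p). if p then a j else - a j)"
  have eq: "(\<Sum>j\<in>J. a j * (W \<theta> d (s j) \<omega> - W \<theta> d (t j) \<omega>)) = (\<Sum>j\<in>?J. b j * W \<theta> d (u j) \<omega>)" for \<theta> \<omega>
    by (simp add: sum.cartesian_product' UNIV_bool u_def b_def right_diff_distrib)
  have u: "u j \<in> {0..\<tau>}" if "j \<in> ?J" for j using that st by (auto simp: u_def)
  have fin: "finite ?J" using J by simp
  show "(LINT \<omega>|M. iexp (\<Sum>j\<in>J. a j * (W 2 d (s j) \<omega> - W 2 d (t j) \<omega>)))
    = (LINT \<omega>|M. iexp (\<Sum>j\<in>J. a j * (W 0 d (s j) \<omega> - W 0 d (t j) \<omega>)))"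
    unfolding eq
    by (subst (1 2) W_combination(4)[where u=u and b=b, OF fin u]) (assumption | simp)+
qed (use st W_measurable in auto)

text \<open>One set \<open>P\<close> of pairs serves all \<open>\<theta>\<close>, \<open>d\<close>
  and \<open>\<epsilon>\<close>, so the events for the process and for its reflection are tested on
  the same increments.\<close>

lemma calm_W_countable:
  obtains P where "countable P" "P \<subseteq> {0..\<tau>} \<times> {0..\<tau>}"
    "\<And>\<theta> d \<epsilon>. calm \<delta> \<epsilon> (W \<theta> d) = {\<omega>\<in>space M. \<forall>p\<in>P. W \<theta> d (fst p) \<omega> - W \<theta> d (snd p) \<omega> \<in> {-\<epsilon>..\<epsilon>}}"
proof -
  obtain Q where Q: "countable Q" "Q \<subseteq> {0..\<tau>}" "{0..\<tau>} \<subseteq> closure Q"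
    by (rule separable)
  show thesis
  proof (rule that[of "{p\<in>Q \<times> Q. \<bar>fst p - snd p\<bar> < \<delta>}"])
    show "countable {p\<in>Q \<times> Q. \<bar>fst p - snd p\<bar> < \<delta>}"
      using Q(1) by (auto intro: countable_subset[of _ "Q \<times> Q"])
    show "{p\<in>Q \<times> Q. \<bar>fst p - snd p\<bar> < \<delta>} \<subseteq> {0..\<tau>} \<times> {0..\<tau>}" using Q by auto
    fix \<theta> d \<epsilon>
    show "calm \<delta> \<epsilon> (W \<theta> d) = {\<omega>\<in>space M. \<forall>p\<in>{p\<in>Q \<times> Q. \<bar>fst p - snd p\<bar> < \<delta>}. W \<theta> d (fst p) \<omega> - W \<theta> d (snd p) \<omega> \<in> {-\<epsilon>..\<epsilon>}}"
      (is "_ = ?R")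
    proof (intro set_eqI iffI)
      fix \<omega> assume "\<omega> \<in> calm \<delta> \<epsilon> (W \<theta> d)"
      then show "\<omega> \<in> ?R" using Q(2) by (fastforce simp: calm_def abs_le_iff)
    next
      fix \<omega> assume \<omega>: "\<omega> \<in> ?R"
      have "\<bar>W \<theta> d s \<omega> - W \<theta> d t \<omega>\<bar> \<le> \<epsilon>" if "s \<in> {0..\<tau>}" "t \<in> {0..\<tau>}" "\<bar>s - t\<bar> < \<delta>" for s t
      proof (rule uniform_increment_bound_dense[where f="\<lambda>t. W \<theta> d t \<omega>", OF W_paths Q(2,3) _ that])
        show "\<omega> \<in> space M" using \<omega> by simp
        show "\<bar>W \<theta> d s \<omega> - W \<theta> d t \<omega>\<bar> \<le> \<epsilon>" if "s \<in> Q" "t \<in> Q" "\<bar>s - t\<bar> < \<delta>" for s t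
          using \<omega> that by (auto simp: abs_le_iff)
      qed
      then show "\<omega> \<in> calm \<delta> \<epsilon> (W \<theta> d)" using \<omega> by (auto simp: calm_def)
    qed
  qed
qed

lemma calm_measurable: "calm \<delta> \<epsilon> (W \<theta> d) \<in> events"
proof -
  obtain P where P: "countable P" "P \<subseteq> {0..\<tau>} \<times> {0..\<tau>}"
    "\<And>\<theta> d \<epsilon>. calm \<delta> \<epsilon> (W \<theta> d) = {\<omega>\<in>space M. \<forall>p\<in>P. W \<theta> d (fst p) \<omega> - W \<theta> d (snd p) \<omega> \<in> {-\<epsilon>..\<epsilon>}}"
    by (rule calm_W_countable) blast
  have [measurable]: "W \<theta> d (fst p) \<in> borel_measurable M" "W \<theta> d (snd p) \<in> borel_measurable M" if "p \<in> P" for p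
    using that P(2) by (auto intro!: W_measurable)
  show ?thesis unfolding P(3) using P(1) by measurable
qed

text \<open>The first \<open>n\<close> increments of an enumeration of \<open>P\<close> satisfy the
  constraint with equal probability for \<open>\<theta> = 2\<close> and \<open>\<theta> = 0\<close>;
  continuity from above gives the limit.\<close>

lemma prob_calm_W2: "prob (calm \<delta> \<epsilon> (W 2 d)) = prob (calm \<delta> \<epsilon> X)"
proof -
  have "X = W 0 d" by (auto simp: W_def fun_eq_iff)
  then have X: "calm \<delta> \<epsilon> X = calm \<delta> \<epsilon> (W 0 d)" by (rule arg_cong)
  obtain P where P: "countable P" "P \<subseteq> {0..\<tau>} \<times> {0..\<tau>}"
    "\<And>\<theta> d \<epsilon>. calm \<delta> \<epsilon> (W \<theta> d) = {\<omega>\<in>space M. \<forall>p\<in>P. W \<theta> d (fst p) \<omega> - W \<theta> d (snd p) \<omega> \<in> {-\<epsilon>..\<epsilon>}}"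
    by (rule calm_W_countable) blast
  show ?thesis
  proof (cases "P = {}")
    case True
    then show ?thesis unfolding X P(3) by simp
  next
    case False
    define e where "e = from_nat_into P"
    have e: "range e = P" unfolding e_def by (rule range_from_nat_into[OF False P(1)])
    then have eP: "e n \<in> P" for n by auto
    then have eT: "e n \<in> {0..\<tau>} \<times> {0..\<tau>}" for n using P(2) by blast
    define A where "A = (\<lambda>\<theta> n. {\<omega>\<in>space M. \<forall>m\<in>{..n}. W \<theta> d (fst (e m)) \<omega> - W \<theta> d (snd (e m)) \<omega> \<in> {-\<epsilon>..\<epsilon>}})"
    have [measurable]: "W \<theta> d (fst (e m)) \<in> borel_measurable M" "W \<theta> d (snd (e m)) \<in> borel_measurable M" for \<theta> m
      using eP[of m] P(2) by (auto intro!: W_measurable)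
    have lim: "(\<lambda>n. prob (A \<theta> n)) \<longlonglongrightarrow> prob (calm \<delta> \<epsilon> (W \<theta> d))" for \<theta>
    proof -
      have "(\<lambda>n. prob (A \<theta> n)) \<longlonglongrightarrow> prob (\<Inter>n. A \<theta> n)"
      proof (rule finite_Lim_measure_decseq)
        show "range (A \<theta>) \<subseteq> events" unfolding A_def by auto
        show "decseq (A \<theta>)" unfolding A_def decseq_def by auto
      qed
      also have "(\<Inter>n. A \<theta> n) = calm \<delta> \<epsilon> (W \<theta> d)"
        unfolding P(3) e[symmetric] A_def by auto
      finally show ?thesis .
    qed
    have "prob (A 2 n) = prob (A 0 n)" for n
      unfolding A_def by (rule prob_increments_W) (use eT in \<open>auto simp: mem_Times_iff\<close>)
    then show ?thesis using LIMSEQ_unique[OF lim[of 2]] lim[of 0] unfolding X by simp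
  qed
qed

lemma calm_X_measurable: "calm \<delta> \<epsilon> X \<in> events"
proof -
  have "X = W 0 0" by (auto simp: W_def fun_eq_iff)
  then have "calm \<delta> \<epsilon> X = calm \<delta> \<epsilon> (W 0 0)" by (rule arg_cong)
  then show ?thesis by (simp only: calm_measurable)
qed

text \<open>Each path is uniformly continuous, so the events increase to the whole space as the
  scale shrinks.\<close>

lemma prob_calm_X_tendsto:
  assumes "0 < \<epsilon>"
  shows "(\<lambda>n. prob (calm (1 / real (Suc n)) \<epsilon> X)) \<longlonglongrightarrow> 1"
proof -
  have "(\<lambda>n. prob (calm (1 / real (Suc n)) \<epsilon> X)) \<longlonglongrightarrow> prob (\<Union>n. calm (1 / real (Suc n)) \<epsilon> X)"
  proof (rule finite_Lim_measure_incseq)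
    show "range (\<lambda>n. calm (1 / real (Suc n)) \<epsilon> X) \<subseteq> events" using calm_X_measurable by auto
    show "incseq (\<lambda>n. calm (1 / real (Suc n)) \<epsilon> X)"
    proof (rule incseq_SucI)
      fix n
      have "1 / real (Suc (Suc n)) \<le> 1 / real (Suc n)" by (rule divide_left_mono) auto
      then show "calm (1 / real (Suc n)) \<epsilon> X \<le> calm (1 / real (Suc (Suc n))) \<epsilon> X"
        unfolding calm_def by (auto dest: less_le_trans)
    qed
  qed
  also have "(\<Union>n. calm (1 / real (Suc n)) \<epsilon> X) = space M"
  proof
    show "space M \<subseteq> (\<Union>n. calm (1 / real (Suc n)) \<epsilon> X)"
    proof
      fix \<omega> assume \<omega>: "\<omega> \<in> space M"
      have "uniformly_continuous_on {0..\<tau>} (\<lambda>t. X t \<omega>)"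
        by (rule compact_uniformly_continuous[OF paths[OF \<omega>]]) simp
      then obtain d where d: "d > 0"
        "\<And>s t. s \<in> {0..\<tau>} \<Longrightarrow> t \<in> {0..\<tau>} \<Longrightarrow> dist t s < d \<Longrightarrow> dist (X t \<omega>) (X s \<omega>) < \<epsilon>"
        by (rule uniformly_continuous_onE) (use assms in blast)+
      obtain n where n: "1 / real (Suc n) < d" using nat_approx_posE[OF d(1)] by blast
      have "\<omega> \<in> calm (1 / real (Suc n)) \<epsilon> X"
        unfolding calm_def
      proof (intro CollectI conjI ballI impI \<omega>)
        fix s t assume "s \<in> {0..\<tau>}" "t \<in> {0..\<tau>}" "\<bar>s - t\<bar> < 1 / real (Suc n)"
        then show "\<bar>X s \<omega> - X t \<omega>\<bar> \<le> \<epsilon>"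
          using d(2)[of t s] n by (auto simp: dist_real_def)
      qed
      then show "\<omega> \<in> (\<Union>n. calm (1 / real (Suc n)) \<epsilon> X)" by blast
    qed
  qed (auto simp: calm_def)
  finally show ?thesis by (simp add: prob_space)
qed

lemma prob_W1_ge:
  assumes s: "s \<in> {0..\<tau>}" and a: "0 < a"
  shows "prob {\<omega>\<in>space M. a \<le> \<bar>W 1 d s \<omega>\<bar>} \<le> r d s s / a\<^sup>2"
proof -
  have i: "integrable M (\<lambda>\<omega>. (W 1 d s \<omega>)\<^sup>2)" and v: "expectation (\<lambda>\<omega>. (W 1 d s \<omega>)\<^sup>2) \<le> r d s s"
    using W_combination(2,3)[of "{()}" "\<lambda>_. s" "\<lambda>_. 1" 1 d] s by (auto simp: r_def power2_eq_square mult_ac)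
  have "prob {\<omega>\<in>space M. (W 1 d s \<omega>)\<^sup>2 \<ge> a\<^sup>2} \<le> expectation (\<lambda>\<omega>. (W 1 d s \<omega>)\<^sup>2) / a\<^sup>2"
    by (rule integral_Markov_inequality_measure[where A="{}"]) (use i a in auto)
  also have "\<dots> \<le> r d s s / a\<^sup>2" using v by (rule divide_right_mono) simp
  finally show ?thesis using a by (simp add: abs_le_square_iff[symmetric])
qed

text \<open>An exceptional event is exhibited, so measurability of the supremum does not enter here.
  Of \<open>\<eta>\<close>, a quarter each goes to the oscillation of the process and of its
  reflection, and half to the net. Of \<open>\<epsilon>\<close>, half bounds the error on the net
  and half its change up to the nearest net point.\<close>

lemma W1_uniformly_small:
  assumes \<epsilon>: "0 < \<epsilon>" and \<eta>: "0 < \<eta>"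
  shows "\<exists>N. \<forall>d\<ge>N. \<exists>E\<in>events. prob E \<le> \<eta> \<and> (\<forall>\<omega>\<in>space M - E. \<forall>t\<in>{0..\<tau>}. \<bar>W 1 d t \<omega>\<bar> \<le> \<epsilon>)"
proof -
  have "\<forall>\<^sub>F n in sequentially. 1 - \<eta> / 4 < prob (calm (1 / real (Suc n)) (\<epsilon> / 2) X)"
    by (rule order_tendstoD(1)[OF prob_calm_X_tendsto]) (use \<epsilon> \<eta> in auto)
  \<comment> \<open>The scale, and with it the net below, depends on \<open>X\<close> alone;
    \<open>d\<close> enters only through the variances on the net.\<close>
  then obtain n where n: "1 - \<eta> / 4 < prob (calm (1 / real (Suc n)) (\<epsilon> / 2) X)"
    by (auto simp: eventually_sequentially)
  define \<delta> where "\<delta> = 1 / real (Suc n)"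
  have \<delta>: "\<delta> > 0" by (simp add: \<delta>_def)
  obtain F where F: "F \<subseteq> {0..\<tau>}" "finite F" "{0..\<tau>} \<subseteq> (\<Union>s\<in>F. ball s \<delta>)"
    by (rule compactE_image[of "{0..\<tau>}" "{0..\<tau>}" "\<lambda>s. ball s \<delta>"]) (use \<delta> in auto)
  have "(\<lambda>d. \<Sum>s\<in>F. r d s s / (\<epsilon> / 2)\<^sup>2) \<longlonglongrightarrow> (\<Sum>s\<in>F. 0 / (\<epsilon> / 2)\<^sup>2)"
    by (intro tendsto_intros r_diag_tendsto_0) (use F \<epsilon> in auto)
  then have "\<forall>\<^sub>F d in sequentially. (\<Sum>s\<in>F. r d s s / (\<epsilon> / 2)\<^sup>2) < \<eta> / 2"
    by (rule order_tendstoD(2)) (use \<eta> in simp)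
  then obtain N where N: "\<And>d. d \<ge> N \<Longrightarrow> (\<Sum>s\<in>F. r d s s / (\<epsilon> / 2)\<^sup>2) < \<eta> / 2"
    unfolding eventually_sequentially by blast
  have "\<exists>E\<in>events. prob E \<le> \<eta> \<and> (\<forall>\<omega>\<in>space M - E. \<forall>t\<in>{0..\<tau>}. \<bar>W 1 d t \<omega>\<bar> \<le> \<epsilon>)" if d: "d \<ge> N" for d
  proof -
    let ?A = "space M - calm \<delta> (\<epsilon> / 2) X" and ?B = "space M - calm \<delta> (\<epsilon> / 2) (W 2 d)"
    let ?C = "\<Union>s\<in>F. {\<omega>\<in>space M. \<epsilon> / 2 \<le> \<bar>W 1 d s \<omega>\<bar>}"
    have [measurable]: "s \<in> F \<Longrightarrow> W 1 d s \<in> borel_measurable M" for s using W_measurable F by blast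
    have Ce: "{\<omega>\<in>space M. \<epsilon> / 2 \<le> \<bar>W 1 d s \<omega>\<bar>} \<in> events" if "s \<in> F" for s
      using that by measurable
    have C: "?C \<in> events" using F(2) Ce by auto
    have AB: "?A \<in> events" "?B \<in> events" using calm_measurable calm_X_measurable by auto
    \<comment> \<open>Equality in law hands the bound for \<open>X\<close> to the reflection for
      every \<open>d\<close>.\<close>
    have pA: "prob ?A \<le> \<eta> / 4" "prob ?B \<le> \<eta> / 4"
      using n prob_compl[OF calm_X_measurable] prob_compl[OF calm_measurable] by (auto simp: prob_calm_W2 \<delta>_def)
    have "prob ?C \<le> (\<Sum>s\<in>F. prob {\<omega>\<in>space M. \<epsilon> / 2 \<le> \<bar>W 1 d s \<omega>\<bar>})"
      by (rule finite_measure_subadditive_finite) (use F Ce in auto)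
    also have "\<dots> \<le> (\<Sum>s\<in>F. r d s s / (\<epsilon> / 2)\<^sup>2)"
      using F \<epsilon> by (intro sum_mono prob_W1_ge) auto
    also have "\<dots> \<le> \<eta> / 2" using N[OF d] by simp
    finally have pC: "prob ?C \<le> \<eta> / 2" .
    have "prob (?A \<union> ?B \<union> ?C) \<le> prob (?A \<union> ?B) + prob ?C"
      by (rule measure_Un_le) (use AB C in auto)
    also have "prob (?A \<union> ?B) \<le> prob ?A + prob ?B"
      by (rule measure_Un_le) (use AB in auto)
    finally have p: "prob (?A \<union> ?B \<union> ?C) \<le> \<eta>" using pA pC by linarith
    have "\<bar>W 1 d t \<omega>\<bar> \<le> \<epsilon>" if \<omega>: "\<omega> \<in> space M - (?A \<union> ?B \<union> ?C)" and t: "t \<in> {0..\<tau>}" for \<omega> t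
    proof -
      obtain s where s: "s \<in> F" "\<bar>t - s\<bar> < \<delta>" using F(3) t by (force simp: dist_real_def abs_minus_commute)
      have "s \<in> {0..\<tau>}" using s F by blast
      then have "\<bar>X t \<omega> - X s \<omega>\<bar> \<le> \<epsilon> / 2" "\<bar>W 2 d t \<omega> - W 2 d s \<omega>\<bar> \<le> \<epsilon> / 2"
        using \<omega> s t unfolding calm_def by auto
      moreover have "\<bar>W 1 d s \<omega>\<bar> < \<epsilon> / 2" using \<omega> s by (auto simp: not_le)
      moreover have "W 1 d s \<omega> = (X s \<omega> + W 2 d s \<omega>) / 2" "W 1 d t \<omega> = (X t \<omega> + W 2 d t \<omega>) / 2"
        by (simp_all add: W_def)
      moreover have "\<bar>(x + y) / 2\<bar> \<le> \<epsilon>"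
        if "\<bar>x - x'\<bar> \<le> \<epsilon> / 2" "\<bar>y - y'\<bar> \<le> \<epsilon> / 2" "\<bar>(x' + y') / 2\<bar> < \<epsilon> / 2" for x x' y y'
        using that by (simp add: abs_if field_simps split: if_splits)
      ultimately show ?thesis by metis
    qed
    then show ?thesis using AB C p by (intro bexI[of _ "?A \<union> ?B \<union> ?C"]) auto
  qed
  then show ?thesis by blast
qed
end

section \<open>From the components to the vector-valued process\<close>

theorem theorem3p3:
  fixes M :: "'a measure"
    and \<tau> :: real
    and G :: "real \<Rightarrow> 'a \<Rightarrow> real ^ 'n"
    and lam :: "'n \<Rightarrow> nat \<Rightarrow> real"
    and \<phi> :: "'n \<Rightarrow> nat \<Rightarrow> real \<Rightarrow> real"
  assumes "prob_space M"
    and "0 < \<tau>"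
    and "gaussian_process M {0..\<tau>} G"
    and "\<And>t. t \<in> {0..\<tau>} \<Longrightarrow> (LINT \<omega>|M. G t \<omega>) = 0"
    and "\<And>\<omega>. \<omega> \<in> space M \<Longrightarrow> continuous_on {0..\<tau>} (\<lambda>t. G t \<omega>)"
    and "\<And>i j. continuous_on ({0..\<tau>} \<times> {0..\<tau>}) (\<lambda>(s, t). corr M G i j s t)"
    and "\<And>i. eigen_system \<tau> (corr M G i i) (lam i) (\<phi> i)"
  shows "tendsto_in_prob M
           (\<lambda>d \<omega>. SUP t\<in>{0..\<tau>}. infnorm (fd_model \<tau> G \<phi> d t \<omega> - G t \<omega>))
           (\<lambda>\<omega>. 0)
           (filtercomap (\<lambda>d :: 'n \<Rightarrow> nat. Min (range d)) at_top)"
proof -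
  interpret prob_space M by fact
  have gauss: "gaussian_rv M (\<lambda>\<omega>. \<Sum>t\<in>F. a t * G t \<omega> $ i)" if "finite F" "F \<subseteq> {0..\<tau>}" for F a i
  proof -
    have "gaussian_rv M (\<lambda>\<omega>. \<Sum>t\<in>F. \<Sum>j\<in>UNIV. (if j = i then a t else 0) * G t \<omega> $ j)"
      using assms(3) that unfolding gaussian_process_def
      by (elim conjE allE[of _ F] allE[of _ "\<lambda>t j. if j = i then a t else 0"]) blast
    moreover have "(\<Sum>j\<in>UNIV. (if j = i then a t else 0) * G t \<omega> $ j) = a t * G t \<omega> $ i" for t \<omega>
    proof -
      have "(\<Sum>j\<in>UNIV. (if j = i then a t else 0) * G t \<omega> $ j) = (\<Sum>j\<in>UNIV. if j = i then a t * G t \<omega> $ j else 0)"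
        by (intro sum.cong) auto
      then show ?thesis by simp
    qed
    ultimately show ?thesis by simp
  qed
  \<comment> \<open>A Bochner integral is 0 by default when the integrand is not integrable, so
    integrability of \<open>G t\<close> is derived from its Gaussian components before the zero mean
    is projected.\<close>
  have mean: "expectation (\<lambda>\<omega>. G t \<omega> $ i) = 0" if t: "t \<in> {0..\<tau>}" for t i
  proof -
    have "integrable M (\<lambda>\<omega>. G t \<omega> $ j)" for j
      using gaussian_rv_integrable[OF gauss[of "{t}" "\<lambda>_. 1" j]] t by simp
    then have "integrable M (\<lambda>\<omega>. \<Sum>j\<in>UNIV. (G t \<omega> $ j) *\<^sub>R axis j 1)"
      by (intro Bochner_Integration.integrable_sum integrable_scaleR_left) simp
    also have "(\<lambda>\<omega>. \<Sum>j\<in>UNIV. (G t \<omega> $ j) *\<^sub>R axis j 1) = G t"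
      by (simp add: fun_eq_iff basis_expansion flip: scalar_mult_eq_scaleR)
    finally have "integrable M (G t)" .
    from integral_bounded_linear[OF bounded_linear_vec_nth[of i] this]
    show ?thesis using assms(4)[OF t] by simp
  qed
  have KL: "karhunen_loeve M \<tau> (\<lambda>t \<omega>. G t \<omega> $ i) (corr M G i i) (lam i) (\<phi> i)" for i
  proof unfold_locales
    show "0 < \<tau>" by fact
    show "gaussian_rv M (\<lambda>\<omega>. \<Sum>t\<in>F. a t * G t \<omega> $ i)" if "finite F" "F \<subseteq> {0..\<tau>}" for F a
      by (rule gauss[OF that])
    show "expectation (\<lambda>\<omega>. G t \<omega> $ i) = 0" if "t \<in> {0..\<tau>}" for t by (rule mean[OF that])
    show "continuous_on {0..\<tau>} (\<lambda>t. G t \<omega> $ i)" if "\<omega> \<in> space M" for \<omega>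
      by (intro continuous_intros assms(5) that)
    show "corr M G i i s t = expectation (\<lambda>\<omega>. G s \<omega> $ i * G t \<omega> $ i)" for s t by (simp add: corr_def)
    show "continuous_on ({0..\<tau>} \<times> {0..\<tau>}) (\<lambda>(s, t). corr M G i i s t)" by (rule assms(6))
    show "eigen_system \<tau> (corr M G i i) (lam i) (\<phi> i)" by (rule assms(7))
  qed
  define w where "w = (\<lambda>i. karhunen_loeve.W \<tau> (\<lambda>t \<omega>. G t \<omega> $ i) (\<phi> i) 1)"
  have w_paths: "continuous_on {0..\<tau>} (\<lambda>t. w i k t \<omega>)" if "\<omega> \<in> space M" for i k \<omega>
    unfolding w_def by (rule karhunen_loeve.W_paths[OF KL that])
  have w_measurable: "w i k t \<in> borel_measurable M" if "t \<in> {0..\<tau>}" for i k t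
    unfolding w_def by (rule karhunen_loeve.W_measurable[OF KL that])
  have fd: "(fd_model \<tau> G \<phi> d t \<omega> - G t \<omega>) $ i = - w i (d i) t \<omega>" if \<omega>: "\<omega> \<in> space M" for d t \<omega> i
  proof -
    interpret K: karhunen_loeve M \<tau> "\<lambda>t \<omega>. G t \<omega> $ i" "corr M G i i" "lam i" "\<phi> i" by (rule KL)
    have "fd_coeff \<tau> G \<phi> i k \<omega> = K.Z k \<omega>" if "1 \<le> k" for k
      unfolding fd_coeff_def K.Z_def
      by (intro LINT_eq_integral_continuous continuous_intros K.paths[OF \<omega>] K.phi_cont[OF that])
    then show ?thesis by (simp add: fd_model_def w_def K.W_def)
  qed
  \<comment> \<open>The maximum norm of the error in terms of the component errors; the sign in
    \<open>fd\<close> disappears under the absolute value.\<close>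
  define h where "h = (\<lambda>d t \<omega>. Max (range (\<lambda>i. \<bar>w i (d i) t \<omega>\<bar>)))"
  have h: "infnorm (fd_model \<tau> G \<phi> d t \<omega> - G t \<omega>) = h d t \<omega>" if "\<omega> \<in> space M" for d t \<omega>
  proof -
    have "infnorm (fd_model \<tau> G \<phi> d t \<omega> - G t \<omega>) = Sup (range (\<lambda>i. \<bar>(fd_model \<tau> G \<phi> d t \<omega> - G t \<omega>) $ i\<bar>))"
      unfolding infnorm_cart by (simp add: full_SetCompr_eq)
    also have "\<dots> = h d t \<omega>" unfolding h_def fd[OF that] by (subst cSup_eq_Max) auto
    finally show ?thesis .
  qed
  have h_le: "h d t \<omega> \<le> e \<longleftrightarrow> (\<forall>i. \<bar>w i (d i) t \<omega>\<bar> \<le> e)" for d t \<omega> e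
    unfolding h_def by (subst Max_le_iff) auto
  have h_nonneg: "0 \<le> h d t \<omega>" for d t \<omega>
    using h_le[of d t \<omega> "h d t \<omega>"] by (meson abs_ge_zero order_refl order_trans)
  have h_cont: "continuous_on {0..\<tau>} (\<lambda>t. h d t \<omega>)" if "\<omega> \<in> space M" for d \<omega>
  proof -
    have "continuous_on {0..\<tau>} (\<lambda>t. infnorm (\<chi> i. w i (d i) t \<omega>))"
      by (intro continuous_on_infnorm continuous_on_vec_lambda w_paths that)
    moreover have "infnorm (\<chi> i. w i (d i) t \<omega>) = h d t \<omega>" for t
      unfolding infnorm_cart h_def by (simp add: full_SetCompr_eq cSup_eq_Max)
    ultimately show ?thesis by simp
  qed
  obtain Q where Q: "countable Q" "Q \<subseteq> {0..\<tau>}" "{0..\<tau>} \<subseteq> closure Q" by (rule separable)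
  then have "Q \<noteq> {}" using \<open>0 < \<tau>\<close> by auto
  define S where "S = (\<lambda>d \<omega>. SUP t\<in>{0..\<tau>}. infnorm (fd_model \<tau> G \<phi> d t \<omega> - G t \<omega>))"
  have S_h: "S d \<omega> = (SUP t\<in>{0..\<tau>}. h d t \<omega>)" if "\<omega> \<in> space M" for d \<omega>
    unfolding S_def by (simp add: h that)
  have bdd: "bdd_above ((\<lambda>t. h d t \<omega>) ` {0..\<tau>})" if "\<omega> \<in> space M" for d \<omega>
    using compact_continuous_image[OF h_cont[OF that]] by (simp add: bounded_imp_bdd_above compact_imp_bounded)
  \<comment> \<open>On \<open>space M\<close> the supremum may be taken over the countable set
    \<open>Q\<close>, since \<open>h\<close> is continuous in \<open>t\<close>.\<close>
  have S_measurable: "S d \<in> borel_measurable M" for d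
  proof -
    have "S d \<in> borel_measurable M \<longleftrightarrow> (\<lambda>\<omega>. SUP t\<in>Q. h d t \<omega>) \<in> borel_measurable M"
      by (rule measurable_cong) (simp only: S_h cSUP_dense[OF h_cont compact_Icc Q(2,3) \<open>Q \<noteq> {}\<close>])
    moreover have "(\<lambda>\<omega>. SUP t\<in>Q. h d t \<omega>) \<in> borel_measurable M"
    proof (rule borel_measurable_cSUP[OF Q(1)])
      show "h d t \<in> borel_measurable M" if "t \<in> Q" for t
        unfolding h_def using w_measurable Q(2) that by (intro borel_measurable_Max borel_measurable_abs) auto
      show "bdd_above ((\<lambda>t. h d t \<omega>) ` Q)" if "\<omega> \<in> space M" for \<omega>
        using bdd[OF that] Q(2) by (meson bdd_above_mono image_mono)
    qed
    ultimately show ?thesis by simp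
  qed
  have S_nonneg: "0 \<le> S d \<omega>" if "\<omega> \<in> space M" for d \<omega>
    unfolding S_h[OF that] using bdd[OF that, of d] h_nonneg[of d 0 \<omega>] \<open>0 < \<tau>\<close>
    by (intro cSUP_upper2[of _ _ 0]) auto
  have "((\<lambda>d. prob {\<omega>\<in>space M. \<epsilon> < \<bar>S d \<omega> - 0\<bar>}) \<longlongrightarrow> 0) (filtercomap (\<lambda>d. Min (range d)) at_top)"
    if \<epsilon>: "0 < \<epsilon>" for \<epsilon>
  proof (rule order_tendstoI)
    fix \<eta> :: real assume "0 < \<eta>"
    \<comment> \<open>A union bound over the components; the factor 2 keeps the total strictly below
      \<open>\<eta>\<close>.\<close>
    define \<eta>' where "\<eta>' = \<eta> / (2 * real CARD('n))"
    have \<eta>': "0 < \<eta>'" "real CARD('n) * \<eta>' < \<eta>" using \<open>0 < \<eta>\<close> by (auto simp: \<eta>'_def)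
    have "\<exists>N. \<forall>k\<ge>N. \<exists>E\<in>events. prob E \<le> \<eta>' \<and> (\<forall>\<omega>\<in>space M - E. \<forall>t\<in>{0..\<tau>}. \<bar>w i k t \<omega>\<bar> \<le> \<epsilon>)" for i
      unfolding w_def by (rule karhunen_loeve.W1_uniformly_small[OF KL \<epsilon> \<eta>'(1)])
    then obtain N where N: "\<And>i k. N i \<le> k \<Longrightarrow>
        \<exists>E\<in>events. prob E \<le> \<eta>' \<and> (\<forall>\<omega>\<in>space M - E. \<forall>t\<in>{0..\<tau>}. \<bar>w i k t \<omega>\<bar> \<le> \<epsilon>)" by metis
    \<comment> \<open>Each component has its own threshold \<open>N i\<close>; if the least
      \<open>d i\<close> is at least the largest threshold, all are met simultaneously.\<close>
    have small: "prob {\<omega>\<in>space M. \<epsilon> < \<bar>S d \<omega> - 0\<bar>} < \<eta>" if d: "Max (range N) \<le> Min (range d)" for d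
    proof -
      have "N i \<le> d i" for i
      proof -
        have "N i \<le> Max (range N)" "Min (range d) \<le> d i" by auto
        then show ?thesis using d by linarith
      qed
      then have "\<exists>E\<in>events. prob E \<le> \<eta>' \<and> (\<forall>\<omega>\<in>space M - E. \<forall>t\<in>{0..\<tau>}. \<bar>w i (d i) t \<omega>\<bar> \<le> \<epsilon>)" for i
        by (rule N)
      then obtain E where E: "\<And>i. E i \<in> events" "\<And>i. prob (E i) \<le> \<eta>'"
        "\<And>i \<omega> t. \<lbrakk>\<omega> \<in> space M - E i; t \<in> {0..\<tau>}\<rbrakk> \<Longrightarrow> \<bar>w i (d i) t \<omega>\<bar> \<le> \<epsilon>" by metis
      have "{\<omega>\<in>space M. \<epsilon> < \<bar>S d \<omega> - 0\<bar>} \<subseteq> (\<Union>i\<in>UNIV. E i)"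
      proof (rule subsetI, rule ccontr)
        fix \<omega> assume \<omega>: "\<omega> \<in> {\<omega>\<in>space M. \<epsilon> < \<bar>S d \<omega> - 0\<bar>}" and nE: "\<omega> \<notin> (\<Union>i\<in>UNIV. E i)"
        have sp: "\<omega> \<in> space M" using \<omega> by simp
        have "S d \<omega> \<le> \<epsilon>"
          unfolding S_h[OF sp] using nE sp E(3) \<open>0 < \<tau>\<close> by (intro cSUP_least) (auto simp: h_le)
        then show False using \<omega> S_nonneg[OF sp, of d] by simp
      qed
      then have "prob {\<omega>\<in>space M. \<epsilon> < \<bar>S d \<omega> - 0\<bar>} \<le> prob (\<Union>i\<in>UNIV. E i)"
        using E(1) by (intro finite_measure_mono) auto
      also have "\<dots> \<le> (\<Sum>i\<in>UNIV. prob (E i))"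
        by (rule finite_measure_subadditive_finite) (use E(1) in auto)
      also have "\<dots> \<le> (\<Sum>i\<in>(UNIV :: 'n set). \<eta>')" by (rule sum_mono) (rule E(2))
      also have "\<dots> < \<eta>" using \<eta>'(2) by simp
      finally show ?thesis .
    qed
    have "\<forall>\<^sub>F m in at_top. Max (range N) \<le> m" by (rule eventually_ge_at_top)
    then have "\<forall>\<^sub>F d in filtercomap (\<lambda>d. Min (range d)) at_top. Max (range N) \<le> Min (range d)"
      by (rule eventually_filtercomapI)
    then show "\<forall>\<^sub>F d in filtercomap (\<lambda>d. Min (range d)) at_top. prob {\<omega>\<in>space M. \<epsilon> < \<bar>S d \<omega> - 0\<bar>} < \<eta>"
      by eventually_elim (rule small)
  next
    fix a :: real assume "a < 0"
    then show "\<forall>\<^sub>F d in filtercomap (\<lambda>d. Min (range d)) at_top. a < prob {\<omega>\<in>space M. \<epsilon> < \<bar>S d \<omega> - 0\<bar>}"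
      by (intro always_eventually allI less_le_trans[OF _ measure_nonneg])
  qed
  then show ?thesis using S_measurable unfolding tendsto_in_prob_def S_def by auto
qed

end
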